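(* $\mathsf{KM}$ (Kelley–Morse theory of classes) is solid.
   Context: Models of $\mathsf{KM}$ are two-sorted structures $(\mathcal{M},\mathcal{A})$ where $\mathcal{M}\models\mathsf{ZF}$, $\mathcal{A}$ is a collection of subsets of $M$ (classes), and $(\mathcal{M},\mathcal{A})$ satisfies the full class comprehension scheme (formulas may quantify over classes) together with the usual Kelley–Morse axioms. A set is $\mathcal{M}$-definable iff definable in $\mathcal{M}$ by a first order formula with parameters; $\mathcal{M}\trianglerighteq_{\mathrm{par}}\mathcal{N}$ means the universe of $\mathcal{N}$ and interpretations of its predicates are $\mathcal{M}$-definable. A first order theory $T$ is solid iff for all models $\mathcal{M},\mathcal{M}^*,\mathcal{N}$ of $T$: if $\mathcal{M}\trianglerighteq_{\mathrm{par}}\mathcal{N}\trianglerighteq_{\mathrm{par}}\mathcal{M}^*$ and there is an $\mathcal{M}$-definable isomorphism $i_0:\mathcal{M}\to\mathcal{M}^*$, then there is an $\mathcal{M}$-definable isomorphism $i:\mathcal{M}\to\mathcal{N}$. *)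

theory Defs
  imports Main
begin

section \<open>First order logic over a relational signature\<close>

text \<open>
  The signature is the type \<open>'p\<close> of predicate symbols together with an arity function;
  identity is a logical symbol. Structures interpret a symbol as a set of tuples (lists) of the
  right length, so an atom with the wrong number of arguments is just a false formula.
\<close>

datatype 'p fm =
    Eq nat nat
  | Pred 'p "nat list"
  | Neg "'p fm"
  | Conj "'p fm" "'p fm"
  | Forall nat "'p fm"

abbreviation Disj :: "'p fm \<Rightarrow> 'p fm \<Rightarrow> 'p fm" where
  "Disj \<phi> \<psi> \<equiv> Neg (Conj (Neg \<phi>) (Neg \<psi>))"

abbreviation Impl :: "'p fm \<Rightarrow> 'p fm \<Rightarrow> 'p fm" where
  "Impl \<phi> \<psi> \<equiv> Neg (Conj \<phi> (Neg \<psi>))"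

abbreviation Equiv :: "'p fm \<Rightarrow> 'p fm \<Rightarrow> 'p fm" where
  "Equiv \<phi> \<psi> \<equiv> Conj (Impl \<phi> \<psi>) (Impl \<psi> \<phi>)"

abbreviation Exists :: "nat \<Rightarrow> 'p fm \<Rightarrow> 'p fm" where
  "Exists x \<phi> \<equiv> Neg (Forall x (Neg \<phi>))"

primrec fv :: "'p fm \<Rightarrow> nat set" where
  "fv (Eq x y) = {x, y}"
| "fv (Pred p xs) = set xs"
| "fv (Neg \<phi>) = fv \<phi>"
| "fv (Conj \<phi> \<psi>) = fv \<phi> \<union> fv \<psi>"
| "fv (Forall x \<phi>) = fv \<phi> - {x}"

record ('a, 'p) struct =
  univ :: "'a set"
  rel :: "'p \<Rightarrow> 'a list set"

definition is_struct :: "('p \<Rightarrow> nat) \<Rightarrow> ('a, 'p) struct \<Rightarrow> bool" where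
  "is_struct ar M \<longleftrightarrow>
     univ M \<noteq> {} \<and> (\<forall>p. rel M p \<subseteq> {as. length as = ar p \<and> set as \<subseteq> univ M})"

primrec sat :: "('a, 'p) struct \<Rightarrow> (nat \<Rightarrow> 'a) \<Rightarrow> 'p fm \<Rightarrow> bool" where
  "sat M v (Eq x y) \<longleftrightarrow> v x = v y"
| "sat M v (Pred p xs) \<longleftrightarrow> map v xs \<in> rel M p"
| "sat M v (Neg \<phi>) \<longleftrightarrow> \<not> sat M v \<phi>"
| "sat M v (Conj \<phi> \<psi>) \<longleftrightarrow> sat M v \<phi> \<and> sat M v \<psi>"
| "sat M v (Forall x \<phi>) \<longleftrightarrow> (\<forall>a\<in>univ M. sat M (v(x := a)) \<phi>)"

text \<open>
  A theory is a set of formulas; free variables in an axiom are read as universally quantified.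
\<close>

definition model_of :: "('p \<Rightarrow> nat) \<Rightarrow> ('a, 'p) struct \<Rightarrow> 'p fm set \<Rightarrow> bool" where
  "model_of ar M T \<longleftrightarrow>
     is_struct ar M \<and> (\<forall>\<phi>\<in>T. \<forall>v. range v \<subseteq> univ M \<longrightarrow> sat M v \<phi>)"


section \<open>Definability, interpretability and solidity\<close>

text \<open>
  Variables \<open>0, \<dots>, n - 1\<close> are the arguments of the defined relation; the assignment \<open>e\<close>
  supplies the (finitely many relevant) parameters for the remaining variables.
\<close>

definition definable :: "('a, 'p) struct \<Rightarrow> nat \<Rightarrow> 'a list set \<Rightarrow> bool" where
  "definable M n R \<longleftrightarrow>
     (\<exists>\<phi> e. range e \<subseteq> univ M \<and>
        R = {as. length as = n \<and> set as \<subseteq> univ M \<and>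
                 sat M (\<lambda>i. if i < n then as ! i else e i) \<phi>})"

definition interprets_par ::
    "('p \<Rightarrow> nat) \<Rightarrow> ('a, 'p) struct \<Rightarrow> ('a, 'p) struct \<Rightarrow> bool" where
  "interprets_par ar M N \<longleftrightarrow>
     definable M 1 {[a] | a. a \<in> univ N} \<and> (\<forall>p. definable M (ar p) (rel N p))"

definition isomorphism :: "('a, 'p) struct \<Rightarrow> ('b, 'p) struct \<Rightarrow> ('a \<Rightarrow> 'b) \<Rightarrow> bool" where
  "isomorphism M N f \<longleftrightarrow>
     bij_betw f (univ M) (univ N) \<and>
     (\<forall>p as. set as \<subseteq> univ M \<longrightarrow> (as \<in> rel M p \<longleftrightarrow> map f as \<in> rel N p))"

definition definable_iso :: "('a, 'p) struct \<Rightarrow> ('a, 'p) struct \<Rightarrow> ('a \<Rightarrow> 'a) \<Rightarrow> bool" where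
  "definable_iso M N f \<longleftrightarrow>
     isomorphism M N f \<and> definable M 2 {[a, f a] | a. a \<in> univ M}"

text \<open>
  HOL cannot quantify over all types inside a formula, so solidity is relative to the type \<open>'a\<close>
  from which the elements of the models are taken. No generality is lost in taking one type for all
  three models, since interpretability makes the universes of \<open>N\<close> and \<open>Ms\<close> subsets of that of \<open>M\<close>.
\<close>

definition solid :: "'a itself \<Rightarrow> ('p \<Rightarrow> nat) \<Rightarrow> 'p fm set \<Rightarrow> bool" where
  "solid _ ar T \<longleftrightarrow>
     (\<forall>(M :: ('a, 'p) struct) Ms N.
        model_of ar M T \<and> model_of ar Ms T \<and> model_of ar N T \<and>
        interprets_par ar M N \<and> interprets_par ar N Ms \<and>
        (\<exists>i0. definable_iso M Ms i0)
        \<longrightarrow> (\<exists>i. definable_iso M N i))"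


section \<open>Kelley--Morse theory of classes\<close>

text \<open>
  A two-sorted structure is presented as a one-sorted one whose universe is the disjoint union of
  the sorts: \<open>SetP\<close> holds of the sets, and the remaining objects are the classes. \<open>MemP\<close> is the
  membership of sets in sets as well as that of sets in classes. By extensionality for classes,
  the classes are, up to isomorphism, a collection of subsets of the sort of sets.
\<close>

datatype km_pred = SetP | MemP

primrec km_arity :: "km_pred \<Rightarrow> nat" where
  "km_arity SetP = 1"
| "km_arity MemP = 2"

type_synonym km_fm = "km_pred fm"

abbreviation IsSet :: "nat \<Rightarrow> km_fm" where
  "IsSet x \<equiv> Pred SetP [x]"

abbreviation Mem :: "nat \<Rightarrow> nat \<Rightarrow> km_fm" where
  "Mem x y \<equiv> Pred MemP [x, y]"

abbreviation ForallS :: "nat \<Rightarrow> km_fm \<Rightarrow> km_fm" where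
  "ForallS x \<phi> \<equiv> Forall x (Impl (IsSet x) \<phi>)"

abbreviation ExistsS :: "nat \<Rightarrow> km_fm \<Rightarrow> km_fm" where
  "ExistsS x \<phi> \<equiv> Exists x (Conj (IsSet x) \<phi>)"

abbreviation ForallC :: "nat \<Rightarrow> km_fm \<Rightarrow> km_fm" where
  "ForallC x \<phi> \<equiv> Forall x (Impl (Neg (IsSet x)) \<phi>)"

abbreviation ExistsC :: "nat \<Rightarrow> km_fm \<Rightarrow> km_fm" where
  "ExistsC x \<phi> \<equiv> Exists x (Conj (Neg (IsSet x)) \<phi>)"

definition km_sorts :: km_fm where
  "km_sorts = Forall 0 (Forall 1 (Impl (Mem 0 1) (IsSet 0)))"

definition km_ext_sets :: km_fm where
  "km_ext_sets =
     ForallS 0 (ForallS 1 (Impl (ForallS 2 (Equiv (Mem 2 0) (Mem 2 1))) (Eq 0 1)))"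

definition km_ext_classes :: km_fm where
  "km_ext_classes =
     ForallC 0 (ForallC 1 (Impl (ForallS 2 (Equiv (Mem 2 0) (Mem 2 1))) (Eq 0 1)))"

definition km_pairing :: km_fm where
  "km_pairing =
     ForallS 0 (ForallS 1 (ExistsS 2 (ForallS 3 (Equiv (Mem 3 2) (Disj (Eq 3 0) (Eq 3 1))))))"

definition km_union :: km_fm where
  "km_union =
     ForallS 0 (ExistsS 1 (ForallS 2
       (Equiv (Mem 2 1) (ExistsS 3 (Conj (Mem 3 0) (Mem 2 3))))))"

definition km_powerset :: km_fm where
  "km_powerset =
     ForallS 0 (ExistsS 1 (ForallS 2
       (Equiv (Mem 2 1) (ForallS 3 (Impl (Mem 3 2) (Mem 3 0))))))"

definition km_infinity :: km_fm where
  "km_infinity =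
     ExistsS 0 (Conj
       (ExistsS 1 (Conj (Mem 1 0) (ForallS 2 (Neg (Mem 2 1)))))
       (ForallS 1 (Impl (Mem 1 0)
         (ExistsS 2 (Conj (Mem 2 0)
           (ForallS 3 (Equiv (Mem 3 2) (Disj (Mem 3 1) (Eq 3 1)))))))))"

definition km_foundation :: km_fm where
  "km_foundation =
     ForallC 0 (Impl (ExistsS 1 (Mem 1 0))
       (ExistsS 1 (Conj (Mem 1 0) (ForallS 2 (Impl (Mem 2 1) (Neg (Mem 2 0)))))))"

text \<open>
  \<open>Upair z x y\<close> says \<open>z = {x, y}\<close>, \<open>Opair p x y\<close> says that \<open>p\<close> is the Kuratowski pair of \<open>x\<close> and \<open>y\<close>,
  and \<open>OpairIn x y F\<close> says that this pair is an element of \<open>F\<close>. The bound variables 10, 11, 12 must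
  not be used as arguments.
\<close>

definition Upair :: "nat \<Rightarrow> nat \<Rightarrow> nat \<Rightarrow> km_fm" where
  "Upair z x y = ForallS 10 (Equiv (Mem 10 z) (Disj (Eq 10 x) (Eq 10 y)))"

definition Opair :: "nat \<Rightarrow> nat \<Rightarrow> nat \<Rightarrow> km_fm" where
  "Opair p x y = ForallS 11 (Equiv (Mem 11 p) (Disj (Upair 11 x x) (Upair 11 x y)))"

definition OpairIn :: "nat \<Rightarrow> nat \<Rightarrow> nat \<Rightarrow> km_fm" where
  "OpairIn x y F = ExistsS 12 (Conj (Opair 12 x y) (Mem 12 F))"

text \<open>
  The image of a set under a class function is a set. The function may be partial, so the axiom
  covers Separation; with Comprehension it yields all instances of the Separation and Replacement
  schemes of ZF.
\<close>

definition km_replacement :: km_fm where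
  "km_replacement =
     ForallC 0 (Impl
       (ForallS 1 (ForallS 2 (ForallS 3
         (Impl (Conj (OpairIn 1 2 0) (OpairIn 1 3 0)) (Eq 2 3)))))
       (ForallS 4 (ExistsS 5 (ForallS 2
         (Equiv (Mem 2 5) (ExistsS 1 (Conj (Mem 1 4) (OpairIn 1 2 0))))))))"

text \<open>
  Full (impredicative) comprehension: \<open>\<phi>\<close> may quantify over classes, and its free variables other
  than \<open>y\<close> are set or class parameters.
\<close>

definition km_comprehension :: "nat \<Rightarrow> nat \<Rightarrow> km_fm \<Rightarrow> km_fm" where
  "km_comprehension X y \<phi> = ExistsC X (ForallS y (Equiv (Mem y X) \<phi>))"

text \<open>
  No choice principle is included: the sets are required to satisfy ZF only.
\<close>

definition KM :: "km_fm set" where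
  "KM = {km_sorts, km_ext_sets, km_ext_classes, km_pairing, km_union, km_powerset,
         km_infinity, km_foundation, km_replacement}
        \<union> {km_comprehension X y \<phi> | X y \<phi>. X \<noteq> y \<and> X \<notin> fv \<phi>}"

end

theory Submission imports Defs begin

text \<open>
  Inside N, let \<open>G\<close> be the union of all partial isomorphisms between transitive collections of sets
  of N and of M*, coded by classes of N. A downward closed bounded part of one side that is carried
  to a bounded part of the other extends \<open>G\<close>, because both sides satisfy separation for all
  predicates definable in N. Hence the domain and the range of \<open>G\<close> are closed under passing to sets
  of smaller rank, and whichever of them is not everything is a set; by foundation they are not both
  sets. If exactly one of them is a set, then one of the two models lives on a set of the other
  together with its subsets, and both possibilities contradict Cantor's theorem, since every object of
  N is an object of M and every object of M* is one of N. So \<open>G\<close> is an isomorphism, definable in N,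
  between the sets of N and those of M*. Composed with the isomorphism of M and M* it identifies the
  sets of M with those of N. This extends to the classes: a class of M is carried via M* to
  a subcollection of the sets of N definable in N, and a class of N is pulled back to one definable in
  M, so full comprehension on both sides makes the two collections of classes correspond.
\<close>

section \<open>Definable predicates\<close>

text \<open>The sets of M* may be classes of N, and no class of N contains a pair with a class as
  component. A partial isomorphism is therefore coded by three classes, which record for each
  argument the elements and the sort of the value. Separation in M* for a predicate P definable in N
  holds because the isomorphism \<open>f\<close> of M and M* is definable in M: P is definable in M,
  hence so is its composite with \<open>f\<close>, and \<open>f\<close> carries this composite back
  to P as a predicate definable in M*. Ranks are compared by an inductively defined preorder, so
  neither ordinals nor choice enter. Both uses of Cantor's theorem send objects to collections of
  sets, and a set and a class with the same elements get the same value. The maps are thus injective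
  only on each of two halves, and the diagonal argument needs a pair of sets instead of one. If
  \<open>G\<close> is not total, the map also involves \<open>f\<close> and is definable in M only;
  the images needed are still sets of N, because \<open>f\<close> carries a predicate definable in M
  to one definable in M*, hence in N.\<close>

primrec ren :: "(nat \<Rightarrow> nat) \<Rightarrow> 'p fm \<Rightarrow> 'p fm" where
  "ren f (Eq x y) = Eq (f x) (f y)"
| "ren f (Pred p xs) = Pred p (map f xs)"
| "ren f (Neg \<phi>) = Neg (ren f \<phi>)"
| "ren f (Conj \<phi> \<psi>) = Conj (ren f \<phi>) (ren f \<psi>)"
| "ren f (Forall x \<phi>) = Forall (f x) (ren f \<phi>)"

text \<open>Bound variables are renamed along with the free ones; injectivity of \<open>f\<close>
  excludes capture.\<close>

lemma sat_ren: "inj f \<Longrightarrow> sat M v (ren f \<phi>) \<longleftrightarrow> sat M (\<lambda>i. v (f i)) \<phi>"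
proof (induction \<phi> arbitrary: v)
  case (Forall x \<phi>)
  have "(\<lambda>i. (v(f x := a)) (f i)) = (\<lambda>i. v (f i))(x := a)" for a
    using Forall.prems by (auto simp: fun_eq_iff inj_eq)
  then show ?case using Forall.IH[OF Forall.prems] by (simp del: fun_upd_apply)
qed (auto simp: comp_def)

lemma finite_fv: "finite (fv \<phi>)"
  by (induction \<phi>) auto

lemma sat_cong_fv: "(\<And>i. i \<in> fv \<phi> \<Longrightarrow> v i = w i) \<Longrightarrow> sat M v \<phi> \<longleftrightarrow> sat M w \<phi>"
proof (induction \<phi> arbitrary: v w)
  case (Pred p xs)
  then have "map v xs = map w xs" by simp
  then show ?case by (simp only: sat.simps)
next
  case (Forall x \<phi>)
  have "sat M (v(x := a)) \<phi> = sat M (w(x := a)) \<phi>" for a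
    by (rule Forall.IH) (use Forall.prems in auto)
  then show ?case by simp
next
  case (Conj \<phi> \<psi>)
  have "sat M v \<phi> = sat M w \<phi>" by (rule Conj.IH) (use Conj.prems in auto)
  moreover have "sat M v \<psi> = sat M w \<psi>" by (rule Conj.IH) (use Conj.prems in auto)
  ultimately show ?case by simp
next
  case (Neg \<phi>)
  have "sat M v \<phi> = sat M w \<phi>" by (rule Neg.IH) (use Neg.prems in auto)
  then show ?case by simp
qed simp

definition asg :: "('a, 'p) struct \<Rightarrow> (nat \<Rightarrow> 'a) \<Rightarrow> bool" where
  "asg M v \<longleftrightarrow> (\<forall>i. v i \<in> univ M)"

lemma asg_range: "asg M v \<longleftrightarrow> range v \<subseteq> univ M"
  by (auto simp: asg_def)

lemma asg_case_nat: "x \<in> univ M \<Longrightarrow> asg M v \<Longrightarrow> asg M (case_nat x v)"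
  by (simp add: asg_def split: nat.split)

text \<open>Only finitely many values of an assignment are arguments of a definable predicate; all other
  variables of the defining formula carry parameters.\<close>

definition dpred :: "('a, 'p) struct \<Rightarrow> ((nat \<Rightarrow> 'a) \<Rightarrow> bool) \<Rightarrow> bool" where
  "dpred M P \<longleftrightarrow> (\<exists>n \<phi> e. asg M e \<and>
     (\<forall>v. asg M v \<longrightarrow> P v = sat M (\<lambda>i. if i < n then v i else e i) \<phi>))"

lemma dpredI:
  assumes "asg M e"
    and "\<And>v. asg M v \<Longrightarrow> P v = sat M (\<lambda>i. if i < n then v i else e i) \<phi>"
  shows "dpred M P"
  using assms unfolding dpred_def by blast

lemma dpredE:
  assumes "dpred M P"
  obtains e n \<phi> where "asg M e"
    and "\<forall>v. asg M v \<longrightarrow> P v = sat M (\<lambda>i. if i < n then v i else e i) \<phi>"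
  using assms unfolding dpred_def by blast

lemma dpred_cong:
  assumes "dpred M P" and "\<And>v. asg M v \<Longrightarrow> Q v = P v"
  shows "dpred M Q"
proof -
  obtain n \<phi> e where "asg M e" "\<forall>v. asg M v \<longrightarrow> P v = sat M (\<lambda>i. if i < n then v i else e i) \<phi>"
    using dpredE[OF assms(1)] .
  then show ?thesis using assms(2) by (intro dpredI[where \<phi> = \<phi> and e = e and n = n]) simp_all
qed

lemma dpred_weaken:
  assumes "dpred M P"
  obtains n e \<phi> where "n \<ge> m" and "asg M e"
    and "\<forall>v. asg M v \<longrightarrow> P v = sat M (\<lambda>i. if i < n then v i else e i) \<phi>"
proof -
  obtain n \<phi> e where e: "asg M e"
    and P: "\<forall>v. asg M v \<longrightarrow> P v = sat M (\<lambda>i. if i < n then v i else e i) \<phi>"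
    using dpredE[OF assms] .
  \<comment> \<open>The parameters move up by \<open>m\<close>, so that positions \<open>n\<close>
    to \<open>n + m - 1\<close> become arguments that do not occur in the renamed formula.\<close>
  define f where "f i = (if i < n then i else i + m)" for i
  have inj: "inj f" by (rule injI) (simp add: f_def split: if_splits)
  show ?thesis
  proof (rule that[of "n + m" "\<lambda>i. e (i - m)" "ren f \<phi>"])
    have eq: "(if f i < n + m then v (f i) else e (f i - m)) = (if i < n then v i else e i)" for v i
      by (simp add: f_def)
    show "\<forall>v. asg M v \<longrightarrow> P v = sat M (\<lambda>i. if i < n + m then v i else e (i - m)) (ren f \<phi>)"
      using P inj by (simp add: sat_ren eq)
  qed (use e in \<open>auto simp: asg_def\<close>)
qed

lemma dpred_not:
  assumes "dpred M P"
  shows "dpred M (\<lambda>v. \<not> P v)"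
proof -
  obtain n \<phi> e where "asg M e" "\<forall>v. asg M v \<longrightarrow> P v = sat M (\<lambda>i. if i < n then v i else e i) \<phi>"
    using dpredE[OF assms] .
  then show ?thesis by (intro dpredI[where \<phi> = "Neg \<phi>" and e = e and n = n]) simp_all
qed

lemma dpred_conj:
  assumes "dpred M P" "dpred M Q"
  shows "dpred M (\<lambda>v. P v \<and> Q v)"
proof -
  obtain n \<phi> e where e: "asg M e"
    and P: "\<forall>v. asg M v \<longrightarrow> P v = sat M (\<lambda>i. if i < n then v i else e i) \<phi>"
    using dpredE[OF assms(1)] .
  obtain m \<psi> d where m: "m \<ge> n" and d: "asg M d"
    and Q: "\<forall>v. asg M v \<longrightarrow> Q v = sat M (\<lambda>i. if i < m then v i else d i) \<psi>"
    using dpred_weaken[OF assms(2), of n] .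
  \<comment> \<open>Both formulas read their arguments below \<open>m\<close>. From there on the
    parameters are interleaved, those of \<open>P\<close> at even and those of \<open>Q\<close> at
    odd offsets.\<close>
  define f where "f i = (if i < n then i else m + 2 * (i - n))" for i
  define g where "g i = (if i < m then i else m + 2 * (i - m) + 1)" for i
  define c where "c i = (if even (i - m) then e (n + (i - m) div 2) else d (m + (i - m) div 2))" for i
  have f: "inj f"
  proof (rule injI)
    fix i j assume "f i = f j"
    then show "i = j" using m by (cases "i < n"; cases "j < n") (simp_all add: f_def)
  qed
  have g: "inj g"
  proof (rule injI)
    fix i j assume "g i = g j"
    then show "i = j" by (cases "i < m"; cases "j < m") (simp_all add: g_def)
  qed
  show ?thesis
  proof (rule dpredI[where e = c and n = m and \<phi> = "Conj (ren f \<phi>) (ren g \<psi>)"])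
    show "asg M c" using e d by (simp add: asg_def c_def)
    fix v :: "nat \<Rightarrow> _" assume v: "asg M v"
    have "(if f i < m then v (f i) else c (f i)) = (if i < n then v i else e i)" for i
      using m by (simp add: f_def c_def)
    moreover have "(if g i < m then v (g i) else c (g i)) = (if i < m then v i else d i)" for i
      by (simp add: g_def c_def)
    ultimately show "(P v \<and> Q v) = sat M (\<lambda>i. if i < m then v i else c i) (Conj (ren f \<phi>) (ren g \<psi>))"
      using P[rule_format, OF v] Q[rule_format, OF v] f g by (simp add: sat_ren)
  qed
qed

lemma dpred_imp:
  assumes "dpred M P" "dpred M Q" shows "dpred M (\<lambda>v. P v \<longrightarrow> Q v)"
  by (rule dpred_cong[OF dpred_not[OF dpred_conj[OF assms(1) dpred_not[OF assms(2)]]]]) blast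

lemma dpred_disj:
  assumes "dpred M P" "dpred M Q" shows "dpred M (\<lambda>v. P v \<or> Q v)"
  by (rule dpred_cong[OF dpred_imp[OF dpred_not[OF assms(1)] assms(2)]]) blast

lemma dpred_iff:
  assumes "dpred M P" "dpred M Q" shows "dpred M (\<lambda>v. P v \<longleftrightarrow> Q v)"
  by (rule dpred_cong[OF dpred_conj[OF dpred_imp[OF assms] dpred_imp[OF assms(2,1)]]]) blast

text \<open>Quantifiers bind variable \<open>0\<close> and shift the remaining ones, in the manner of de Bruijn.\<close>

lemma dpred_all:
  assumes "dpred M (\<lambda>w. Q (w 0) (\<lambda>i. w (Suc i)))"
  shows "dpred M (\<lambda>v. \<forall>x\<in>univ M. Q x v)"
proof -
  obtain n' \<phi> e where n': "n' \<ge> 1" and e: "asg M e"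
    and Q: "\<forall>v. asg M v \<longrightarrow>
      Q (v 0) (\<lambda>i. v (Suc i)) = sat M (\<lambda>i. if i < n' then v i else e i) \<phi>"
    using dpred_weaken[OF assms, of 1] .
  define n where "n = n' - 1"
  have n: "n' = Suc n" using n' by (simp add: n_def)
  \<comment> \<open>The quantified variable 0 takes the position \<open>n\<close>, which the other
    arguments vacate by shifting down; the parameters stay in place.\<close>
  define f where "f i = (if i = 0 then n else if i \<le> n then i - 1 else i)" for i
  have f: "inj f"
  proof (rule injI)
    fix i j assume "f i = f j"
    then show "i = j" by (cases i; cases j) (simp_all add: f_def split: if_splits)
  qed
  show ?thesis
  proof (rule dpredI[where e = e and n = n and \<phi> = "Forall n (ren f \<phi>)", OF e])
    fix v :: "nat \<Rightarrow> _" assume v: "asg M v"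
    let ?v = "\<lambda>i. if i < n then v i else e i"
    have "Q x v = sat M (?v(n := x)) (ren f \<phi>)" if "x \<in> univ M" for x
    proof -
      have "(?v(n := x)) (f i) = (if i < n' then case_nat x v i else e i)" for i
        unfolding n by (cases i) (simp_all add: f_def)
      then show ?thesis using Q[rule_format, OF asg_case_nat[OF that v]] f by (simp add: sat_ren del: fun_upd_apply)
    qed
    then show "(\<forall>x\<in>univ M. Q x v) = sat M ?v (Forall n (ren f \<phi>))" by simp
  qed
qed

lemma dpred_ex:
  assumes "dpred M (\<lambda>w. Q (w 0) (\<lambda>i. w (Suc i)))"
  shows "dpred M (\<lambda>v. \<exists>x\<in>univ M. Q x v)"
proof -
  have "dpred M (\<lambda>v. \<not> (\<forall>x\<in>univ M. \<not> Q x v))"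
    by (intro dpred_not dpred_all assms)
  then show ?thesis by simp
qed

section \<open>Substitution of variables and constants\<close>

definition dterm :: "('a, 'p) struct \<Rightarrow> ((nat \<Rightarrow> 'a) \<Rightarrow> 'a) \<Rightarrow> bool" where
  "dterm M s \<longleftrightarrow> (\<exists>k. s = (\<lambda>v. v k)) \<or> (\<exists>c\<in>univ M. s = (\<lambda>v. c))"

lemma dterm_var: "dterm M (\<lambda>v. v k)"
  and dterm_const: "c \<in> univ M \<Longrightarrow> dterm M (\<lambda>v. c)"
  unfolding dterm_def by auto

lemma dterm_in: "dterm M s \<Longrightarrow> asg M v \<Longrightarrow> s v \<in> univ M"
  unfolding dterm_def asg_def by auto

lemma dterm_case_nat:
  assumes "\<And>i. dterm M (T i)"
  shows "dterm M (\<lambda>w. ((\<lambda>i. T i (\<lambda>i. w (Suc i)))(x := w 0)) i)"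
proof (cases "i = x")
  case True then show ?thesis by (simp add: dterm_var)
next
  case False then show ?thesis using assms[of i] by (auto simp: dterm_def)
qed

lemma sat_ren_atom:
  "\<phi> = Eq x y \<or> \<phi> = Pred p xs \<Longrightarrow> sat M v (ren f \<phi>) \<longleftrightarrow> sat M (\<lambda>i. v (f i)) \<phi>"
  by (auto simp: comp_def)

text \<open>Different variables may be sent to the same term, so the renaming is not injective. This
  is harmless in an atom, which binds nothing.\<close>

lemma dpred_atom:
  assumes T: "\<And>i. dterm M (T i)" and \<phi>: "\<phi> = Eq x y \<or> \<phi> = Pred p xs" and "univ M \<noteq> {}"
  shows "dpred M (\<lambda>v. sat M (\<lambda>i. T i v) \<phi>)"
proof -
  obtain c where c: "c \<in> univ M" using assms(3) by blast
  have "\<exists>s. (\<forall>k. s = Inl k \<longrightarrow> T i = (\<lambda>v. v k)) \<and> (\<forall>c. s = Inr c \<longrightarrow> c \<in> univ M \<and> T i = (\<lambda>v. c))" for i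
  proof -
    consider k where "T i = (\<lambda>v. v k)" | c where "c \<in> univ M" "T i = (\<lambda>v. c)"
      using T[of i] unfolding dterm_def by blast
    then show ?thesis
    proof cases
      case 1 then show ?thesis by (intro exI[where x = "Inl k"]) simp
    next
      case 2 then show ?thesis by (intro exI[where x = "Inr c"]) simp
    qed
  qed
  then obtain s :: "nat \<Rightarrow> nat + 'a" where "\<forall>i. (\<forall>k. s i = Inl k \<longrightarrow> T i = (\<lambda>v. v k)) \<and>
      (\<forall>c. s i = Inr c \<longrightarrow> c \<in> univ M \<and> T i = (\<lambda>v. c))"
    using choice[of "\<lambda>i s. (\<forall>k. s = Inl k \<longrightarrow> T i = (\<lambda>v. v k)) \<and>
      (\<forall>c. s = Inr c \<longrightarrow> c \<in> univ M \<and> T i = (\<lambda>v. c))"] by blast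
  then have s: "\<And>i k. s i = Inl k \<Longrightarrow> T i = (\<lambda>v. v k)"
    "\<And>i c. s i = Inr c \<Longrightarrow> c \<in> univ M \<and> T i = (\<lambda>v. c)" by simp_all
  define ix where "ix i = (case s i of Inl k \<Rightarrow> k | Inr c \<Rightarrow> 0)" for i
  have "finite (ix ` fv \<phi>)" by (simp add: finite_fv)
  then obtain n where n: "\<And>i. i \<in> fv \<phi> \<Longrightarrow> ix i < n"
    using finite_nat_set_iff_bounded by auto
  \<comment> \<open>Constants become parameters at the positions \<open>n + i\<close>, where
    \<open>n\<close> exceeds every variable substituted for a free variable of the atom.\<close>
  define f where "f i = (case s i of Inl k \<Rightarrow> k | Inr c \<Rightarrow> n + i)" for i
  define e where "e i = (case s (i - n) of Inl k \<Rightarrow> c | Inr d \<Rightarrow> d)" for i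
  show ?thesis
  proof (rule dpredI[where n = n and e = e and \<phi> = "ren f \<phi>"])
    show "asg M e" using c s by (auto simp: asg_def e_def split: sum.split)
    fix v :: "nat \<Rightarrow> _" assume "asg M v"
    have "sat M (\<lambda>i. T i v) \<phi> = sat M (\<lambda>i. if f i < n then v (f i) else e (f i)) \<phi>"
    proof (rule sat_cong_fv)
      fix i assume "i \<in> fv \<phi>"
      then have "ix i < n" by (rule n)
      then show "T i v = (if f i < n then v (f i) else e (f i))"
        using s[of i] by (cases "s i") (simp_all add: ix_def f_def e_def)
    qed
    then show "sat M (\<lambda>i. T i v) \<phi> = sat M (\<lambda>i. if i < n then v i else e i) (ren f \<phi>)"
      by (simp only: sat_ren_atom[OF \<phi>])
  qed
qed

text \<open>The case \<open>N = M\<close> gives substitution of terms into formulas, the general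
  case the translation of formulas about an interpreted structure. Quantifiers go through
  \<open>dpred_all\<close>, so capture never has to be discussed.\<close>

lemma dpred_sat_of_atoms:
  assumes U: "dpred M (\<lambda>v. v 0 \<in> univ N)" "univ N \<subseteq> univ M" and ne: "univ M \<noteq> {}"
    and atom: "\<And>p (xs :: nat list) T. (\<And>i. dterm M (T i)) \<Longrightarrow> dpred M (\<lambda>v. map (\<lambda>i. T i v) xs \<in> rel N p)"
  shows "(\<And>i. dterm M (T i)) \<Longrightarrow> dpred M (\<lambda>v. sat N (\<lambda>i. T i v) \<phi>)"
proof (induction \<phi> arbitrary: T)
  case (Eq x y)
  have "dpred M (\<lambda>v. sat M (\<lambda>i. T i v) (Eq x y :: 'b fm))"
    by (rule dpred_atom[OF Eq _ ne]) simp
  then show ?case by simp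
next
  case (Pred p xs)
  show ?case unfolding sat.simps by (rule atom) (rule Pred)
next
  case (Forall x \<phi>)
  \<comment> \<open>The variable bound by the quantifier becomes the new variable 0, and the old
    terms are shifted past it.\<close>
  define T' where "T' i = (\<lambda>w. ((\<lambda>i. T i (\<lambda>i. w (Suc i)))(x := w 0)) i)" for i
  have "dterm M (T' i)" for i
    unfolding T'_def by (rule dterm_case_nat[OF Forall.prems])
  then have "dpred M (\<lambda>w. sat N (\<lambda>i. T' i w) \<phi>)"
    by (rule Forall.IH)
  moreover have T': "(\<lambda>i. T' i w) = (\<lambda>i. T i (\<lambda>i. w (Suc i)))(x := w 0)" for w
    by (auto simp: T'_def)
  ultimately have "dpred M (\<lambda>w. w 0 \<in> univ N \<longrightarrow> sat N ((\<lambda>i. T i (\<lambda>i. w (Suc i)))(x := w 0)) \<phi>)"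
    unfolding T' by (intro dpred_imp[OF U(1)])
  then   have "dpred M (\<lambda>v. \<forall>a\<in>univ M. a \<in> univ N \<longrightarrow> sat N ((\<lambda>i. T i v)(x := a)) \<phi>)"
    by (rule dpred_all)
  then show ?case
  proof (rule dpred_cong)
    fix v
    show "sat N (\<lambda>i. T i v) (Forall x \<phi>) =
      (\<forall>a\<in>univ M. a \<in> univ N \<longrightarrow> sat N ((\<lambda>i. T i v)(x := a)) \<phi>)"
      using U(2) by (simp only: sat.simps) blast
  qed
next
  case (Neg \<phi>)
  show ?case unfolding sat.simps by (rule dpred_not) (rule Neg.IH, rule Neg.prems)
next
  case (Conj \<phi> \<psi>)
  show ?case unfolding sat.simps
    by (rule dpred_conj) (rule Conj.IH, rule Conj.prems)+
qed

lemma dpred_sat: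
  assumes "univ M \<noteq> {}" and "\<And>i. dterm M (T i)"
  shows "dpred M (\<lambda>v. sat M (\<lambda>i. T i v) \<phi>)"
proof (rule dpred_sat_of_atoms[where M = M and N = M and T = T and \<phi> = \<phi>])
  obtain c where "c \<in> univ M" using assms(1) by blast
  then have "asg M (\<lambda>_. c)" by (simp add: asg_def)
  then show "dpred M (\<lambda>v. v 0 \<in> univ M)"
    by (rule dpredI[where \<phi> = "Eq 0 0"]) (simp add: asg_def)
  show "dpred M (\<lambda>v. map (\<lambda>i. T i v) xs \<in> rel M p)" if "\<And>i. dterm M (T i)"
    for p and xs :: "nat list" and T
    using dpred_atom[of M T "Pred p xs", OF that _ assms(1)] by simp
  show "dterm M (T i)" for i by (rule assms(2))
qed (use assms(1) in simp_all)

lemma dpred_subst: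
  assumes "dpred M P" and T: "\<And>i. dterm M (T i)"
  shows "dpred M (\<lambda>v. P (\<lambda>i. T i v))"
proof -
  obtain n \<phi> e where e: "asg M e"
    and P: "\<forall>v. asg M v \<longrightarrow> P v = sat M (\<lambda>i. if i < n then v i else e i) \<phi>"
    using dpredE[OF assms(1)] .
  define T' where "T' i = (if i < n then T i else (\<lambda>v. e i))" for i
  have "dpred M (\<lambda>v. sat M (\<lambda>i. T' i v) \<phi>)"
    using e T by (intro dpred_sat) (auto simp: T'_def asg_def intro: dterm_const)
  then show ?thesis
  proof (rule dpred_cong)
    fix v :: "nat \<Rightarrow> _" assume v: "asg M v"
    have "asg M (\<lambda>i. T i v)" using dterm_in[OF T v] by (simp add: asg_def)
    moreover have "(\<lambda>i. T' i v) = (\<lambda>i. if i < n then T i v else e i)" by (auto simp: T'_def)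
    ultimately show "P (\<lambda>i. T i v) = sat M (\<lambda>i. T' i v) \<phi>"
      using P[rule_format, of "\<lambda>i. T i v"] by (simp only:)
  qed
qed

lemma dpred_eq:
  assumes "univ M \<noteq> {}" "dterm M s" "dterm M t"
  shows "dpred M (\<lambda>v. s v = t v)"
proof -
  define T where "T i = (if i = 0 then s else t)" for i :: nat
  have "dpred M (\<lambda>v. sat M (\<lambda>i. T i v) (Eq 0 1 :: 'b fm))"
    by (rule dpred_sat) (use assms in \<open>simp_all add: T_def\<close>)
  then show ?thesis by (simp add: T_def)
qed

section \<open>Predicates of fixed arity, applied to terms\<close>

definition dpred1 :: "('a, 'p) struct \<Rightarrow> ('a \<Rightarrow> bool) \<Rightarrow> bool" where
  "dpred1 M P \<longleftrightarrow> dpred M (\<lambda>v. P (v 0))"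

definition dpred2 :: "('a, 'p) struct \<Rightarrow> ('a \<Rightarrow> 'a \<Rightarrow> bool) \<Rightarrow> bool" where
  "dpred2 M P \<longleftrightarrow> dpred M (\<lambda>v. P (v 0) (v (Suc 0)))"

definition dpred3 :: "('a, 'p) struct \<Rightarrow> ('a \<Rightarrow> 'a \<Rightarrow> 'a \<Rightarrow> bool) \<Rightarrow> bool" where
  "dpred3 M P \<longleftrightarrow> dpred M (\<lambda>v. P (v 0) (v (Suc 0)) (v (Suc (Suc 0))))"

lemma dpred1_app:
  assumes "dpred1 M P" "dterm M s"
  shows "dpred M (\<lambda>v. P (s v))"
  using dpred_subst[of M "\<lambda>v. P (v 0)" "\<lambda>i. s"] assms by (simp add: dpred1_def)

lemma dpred2_app:
  assumes "dpred2 M P" "dterm M s" "dterm M t"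
  shows "dpred M (\<lambda>v. P (s v) (t v))"
  using dpred_subst[of M "\<lambda>v. P (v 0) (v (Suc 0))" "\<lambda>i. if i = 0 then s else t"] assms
  by (simp add: dpred2_def)

lemma dpred3_app:
  assumes "dpred3 M P" "dterm M s" "dterm M t" "dterm M u"
  shows "dpred M (\<lambda>v. P (s v) (t v) (u v))"
  using dpred_subst[of M "\<lambda>v. P (v 0) (v (Suc 0)) (v (Suc (Suc 0)))"
      "\<lambda>i. if i = 0 then s else if i = 1 then t else u"] assms
  by (simp add: dpred3_def)

section \<open>Definable relations, interpretations and isomorphisms\<close>

lemma dpred_definable:
  assumes "definable M n R" "univ M \<noteq> {}" and T: "\<And>i. dterm M (T i)"
  shows "dpred M (\<lambda>v. map (\<lambda>i. T i v) xs \<in> R)"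
proof -
  obtain \<phi> e where e: "range e \<subseteq> univ M"
    and R: "R = {as. length as = n \<and> set as \<subseteq> univ M \<and>
                 sat M (\<lambda>i. if i < n then as ! i else e i) \<phi>}"
    using assms(1) unfolding definable_def by blast
  define T' where "T' i = (if i < n then T (xs ! i) else (\<lambda>v. e i))" for i
  have d: "dpred M (\<lambda>v. sat M (\<lambda>i. T' i v) \<phi>)"
  proof (rule dpred_sat[OF assms(2)])
    show "dterm M (T' i)" for i
      using T e by (cases "i < n") (auto simp: T'_def intro!: dterm_const)
  qed
  show ?thesis
  proof (cases "length xs = n")
    case True
    show ?thesis
    proof (rule dpred_cong[OF d])
      fix v assume v: "asg M v"
      have "(\<lambda>i. T' i v) = (\<lambda>i. if i < n then map (\<lambda>i. T i v) xs ! i else e i)"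
        using True by (auto simp: T'_def)
      then show "map (\<lambda>i. T i v) xs \<in> R \<longleftrightarrow> sat M (\<lambda>i. T' i v) \<phi>"
        using True dterm_in[OF T v] by (auto simp: R)
    qed
  next
    case False
    show ?thesis
    proof (rule dpred_cong)
      show "dpred M (\<lambda>v. v 0 \<noteq> v 0)"
        by (rule dpred_not[OF dpred_eq[OF assms(2) dterm_var dterm_var]])
    qed (use False R in simp)
  qed
qed

lemma definable_dpred2:
  assumes "dpred2 M R"
  shows "definable M 2 {[a, b] | a b. a \<in> univ M \<and> b \<in> univ M \<and> R a b}"
proof -
  obtain n e \<phi> where n: "n \<ge> 2" and e: "asg M e"
    and P: "\<forall>v. asg M v \<longrightarrow> R (v 0) (v (Suc 0)) = sat M (\<lambda>i. if i < n then v i else e i) \<phi>"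
    using dpred_weaken[OF assms[unfolded dpred2_def]] .
  \<comment> \<open>The arguments from 2 up to \<open>n\<close> become parameters. Since
    \<open>R\<close> depends on the first two only, any value such as \<open>e 0\<close> will
    do.\<close>
  define d where "d i = (if i < n then e 0 else e i)" for i
  have "R a b = sat M (\<lambda>i. if i < 2 then [a, b] ! i else d i) \<phi>"
    if "a \<in> univ M" "b \<in> univ M" for a b
  proof -
    let ?v = "\<lambda>i. if i < 2 then [a, b] ! i else e 0"
    have "asg M ?v" using that e by (auto simp: asg_def less_2_cases_iff)
    moreover have "(\<lambda>i. if i < n then ?v i else e i) = (\<lambda>i. if i < 2 then [a, b] ! i else d i)"
      using n by (auto simp: d_def)
    ultimately show ?thesis using P[rule_format, of ?v] by simp
  qed
  then have "{[a, b] | a b. a \<in> univ M \<and> b \<in> univ M \<and> R a b} = {as. length as = 2 \<and> set as \<subseteq> univ M \<and>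
                 sat M (\<lambda>i. if i < 2 then as ! i else d i) \<phi>}"
    by (auto simp: length_Suc_conv numeral_2_eq_2)
  moreover have "range d \<subseteq> univ M" using e by (auto simp: d_def asg_def)
  ultimately show ?thesis unfolding definable_def by blast
qed

lemma definable_set:
  assumes "definable M n R" "as \<in> R"
  shows "length as = n" "set as \<subseteq> univ M"
  using assms unfolding definable_def by auto

lemma interprets_univ:
  assumes "interprets_par ar M N"
  shows "univ N \<subseteq> univ M"
proof
  fix x assume "x \<in> univ N"
  then have "[x] \<in> {[a] | a. a \<in> univ N}" by simp
  moreover have "definable M 1 {[a] | a. a \<in> univ N}"
    using assms unfolding interprets_par_def by (rule conjunct1)
  ultimately show "x \<in> univ M"
    using definable_set(2)[of M 1 "{[a] | a. a \<in> univ N}" "[x]"] by simp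
qed

lemma dpred_interp_univ:
  assumes "interprets_par ar M N" "univ M \<noteq> {}"
  shows "dpred1 M (\<lambda>x. x \<in> univ N)"
proof -
  have "definable M 1 {[a] | a. a \<in> univ N}"
    using assms(1) unfolding interprets_par_def by (rule conjunct1)
  then have "dpred M (\<lambda>v. map (\<lambda>i. v 0) [0 :: nat] \<in> {[a] | a. a \<in> univ N})"
    by (rule dpred_definable[OF _ assms(2) dterm_var])
  then show ?thesis by (simp add: dpred1_def)
qed

text \<open>The guard \<open>Q\<close> keeps the arguments inside \<open>N\<close>; definability of
  \<open>P\<close> in \<open>N\<close> says nothing about other assignments.\<close>

lemma dpred_interp:
  assumes I: "interprets_par ar M N" and ne: "univ M \<noteq> {}"
    and P: "dpred N P" and Q: "dpred M Q"
    and T: "\<And>i. dterm M (T i)" and QT: "\<And>v. Q v \<Longrightarrow> asg N (\<lambda>i. T i v)"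
  shows "dpred M (\<lambda>v. Q v \<and> P (\<lambda>i. T i v))"
proof -
  obtain e n \<phi> where e: "asg N e"
    and P: "\<forall>v. asg N v \<longrightarrow> P v = sat N (\<lambda>i. if i < n then v i else e i) \<phi>"
    using dpredE[OF P] .
  define T' where "T' i = (if i < n then T i else (\<lambda>v. e i))" for i
  have T': "dterm M (T' i)" for i
    using T e interprets_univ[OF I] by (auto simp: T'_def asg_def intro!: dterm_const)
  have "dpred M (\<lambda>v. sat N (\<lambda>i. T' i v) \<phi>)"
  proof (rule dpred_sat_of_atoms[OF _ interprets_univ[OF I] ne])
    show "dpred M (\<lambda>v. v 0 \<in> univ N)"
      using dpred_interp_univ[OF I ne] by (simp add: dpred1_def)
    show "dpred M (\<lambda>v. map (\<lambda>i. T i v) xs \<in> rel N p)" if "\<And>i. dterm M (T i)"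
      for p and xs :: "nat list" and T
    proof (rule dpred_definable[OF _ ne that])
      show "definable M (ar p) (rel N p)" using I by (simp add: interprets_par_def)
    qed
  qed (rule T')
  then have "dpred M (\<lambda>v. Q v \<and> sat N (\<lambda>i. T' i v) \<phi>)"
    by (rule dpred_conj[OF Q])
  then show ?thesis
  proof (rule dpred_cong)
    fix v
    have "P (\<lambda>i. T i v) = sat N (\<lambda>i. T' i v) \<phi>" if "Q v"
    proof -
      have "(\<lambda>i. T' i v) = (\<lambda>i. if i < n then T i v else e i)" by (auto simp: T'_def)
      then show ?thesis using P QT[OF that] by simp
    qed
    then show "(Q v \<and> P (\<lambda>i. T i v)) = (Q v \<and> sat N (\<lambda>i. T' i v) \<phi>)" by blast
  qed
qed

lemma dpred1_interp:
  assumes I: "interprets_par ar M N" and ne: "univ M \<noteq> {}" and P: "dpred1 N P"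
  shows "dpred1 M (\<lambda>x. x \<in> univ N \<and> P x)"
  unfolding dpred1_def
  by (rule dpred_interp[OF I ne P[unfolded dpred1_def] _, where T = "\<lambda>i v. v 0"])
    (use dpred_interp_univ[OF I ne] in \<open>simp_all add: dpred1_def dterm_var asg_def\<close>)

lemma dpred2_interp:
  fixes M :: "('a, 'p) struct"
  assumes I: "interprets_par ar M N" and ne: "univ M \<noteq> {}" and P: "dpred2 N P"
  shows "dpred2 M (\<lambda>x y. x \<in> univ N \<and> y \<in> univ N \<and> P x y)"
proof -
  \<comment> \<open>Every variable after the first receives the second argument, so that guarding
    two arguments makes the whole assignment one into \<open>N\<close>.\<close>
  define T :: "nat \<Rightarrow> (nat \<Rightarrow> 'a) \<Rightarrow> 'a" where "T i = (\<lambda>v. v (if i = 0 then 0 else Suc 0))" for i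
  have "dpred M (\<lambda>v. v 0 \<in> univ N \<and> v (Suc 0) \<in> univ N)"
    by (intro dpred_conj dpred1_app[OF dpred_interp_univ[OF I ne]] dterm_var)
  then have "dpred M (\<lambda>v. (v 0 \<in> univ N \<and> v (Suc 0) \<in> univ N) \<and> P (T 0 v) (T (Suc 0) v))"
    by (rule dpred_interp[OF I ne P[unfolded dpred2_def]])
      (simp_all add: T_def dterm_var asg_def)
  then show ?thesis by (simp add: dpred2_def T_def)
qed

lemma isomorphism_sat:
  assumes "isomorphism M N f"
  shows "asg M v \<Longrightarrow> sat M v \<phi> \<longleftrightarrow> sat N (\<lambda>i. f (v i)) \<phi>"
proof (induction \<phi> arbitrary: v)
  case (Eq x y)
  have "inj_on f (univ M)" using assms by (auto simp: isomorphism_def bij_betw_def)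
  then show ?case using Eq by (auto simp: asg_def inj_on_def)
next
  case (Pred p xs)
  have "set (map v xs) \<subseteq> univ M" using Pred by (auto simp: asg_def)
  then have "(map v xs \<in> rel M p) = (map f (map v xs) \<in> rel N p)"
    using assms by (simp only: isomorphism_def)
  then show ?case by (simp add: comp_def)
next
  case (Forall x \<phi>)
  have *: "(\<lambda>i. f (v i))(x := f a) = (\<lambda>i. f ((v(x := a)) i))" for a by auto
  have "sat M (v(x := a)) \<phi> = sat N ((\<lambda>i. f (v i))(x := f a)) \<phi>" if "a \<in> univ M" for a
    unfolding * by (rule Forall.IH) (use that Forall.prems in \<open>simp add: asg_def\<close>)
  moreover have "univ N = f ` univ M" using assms by (simp add: isomorphism_def bij_betw_def)
  ultimately show ?case by simp
qed auto

text \<open>The same formula works; \<open>f\<close> moves its parameters.\<close>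

lemma dpred_iso:
  assumes iso: "isomorphism M N f" and P: "dpred M P"
  shows "dpred N (\<lambda>v. P (\<lambda>i. inv_into (univ M) f (v i)))"
proof -
  obtain e n \<phi> where e: "asg M e"
    and P: "\<forall>v. asg M v \<longrightarrow> P v = sat M (\<lambda>i. if i < n then v i else e i) \<phi>"
    using dpredE[OF P] .
  have b: "bij_betw f (univ M) (univ N)" using iso by (simp add: isomorphism_def)
  show ?thesis
  proof (rule dpredI)
    show "asg N (\<lambda>i. f (e i))" using e bij_betwE[OF b] by (simp add: asg_def)
    fix v assume v: "asg N v"
    let ?w = "\<lambda>i. inv_into (univ M) f (v i)"
    have w: "asg M ?w" "\<And>i. f (?w i) = v i"
      using v b by (auto simp: asg_def bij_betw_def inv_into_into f_inv_into_f)
    have "(\<lambda>i. f (if i < n then ?w i else e i)) = (\<lambda>i. if i < n then v i else f (e i))"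
      using w(2) by auto
    moreover have "asg M (\<lambda>i. if i < n then ?w i else e i)"
      using w(1) e by (simp add: asg_def)
    ultimately show "P ?w = sat N (\<lambda>i. if i < n then v i else f (e i)) \<phi>"
      using P w(1) isomorphism_sat[OF iso] by simp
  qed
qed

section \<open>Set theory inside a model of KM\<close>

definition is_set :: "('a, km_pred) struct \<Rightarrow> 'a \<Rightarrow> bool" where
  "is_set K x \<longleftrightarrow> [x] \<in> rel K SetP"

definition mem :: "('a, km_pred) struct \<Rightarrow> 'a \<Rightarrow> 'a \<Rightarrow> bool" where
  "mem K x y \<longleftrightarrow> [x, y] \<in> rel K MemP"

locale km_model =
  fixes K :: "('a, km_pred) struct"
  assumes model: "model_of km_arity K KM"
begin

abbreviation U where "U \<equiv> univ K"
abbreviation S where "S \<equiv> is_set K"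
abbreviation E where "E \<equiv> mem K"

lemma ne: "U \<noteq> {}"
  using model by (simp add: model_of_def is_struct_def)

lemma sat_KM: "\<phi> \<in> KM \<Longrightarrow> asg K v \<Longrightarrow> sat K v \<phi>"
  using model by (simp add: model_of_def asg_range)

lemma dpred1_set: "dpred1 K S"
proof -
  have "dpred K (\<lambda>v. sat K (\<lambda>i. v 0) (IsSet 0))"
    by (rule dpred_sat[OF ne dterm_var])
  then show ?thesis by (simp add: is_set_def dpred1_def)
qed

lemma dpred2_mem: "dpred2 K E"
proof -
  have "dpred K (\<lambda>v. sat K (\<lambda>i. v i) (Mem 0 1))"
    by (rule dpred_sat[OF ne dterm_var])
  then show ?thesis by (simp add: mem_def dpred2_def)
qed

lemmas dpred_rules = dpred_not dpred_conj dpred_disj dpred_imp dpred_iff dpred_all dpred_ex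
  dpred_eq[OF ne] dpred1_app[OF dpred1_set] dpred2_app[OF dpred2_mem] dterm_var dterm_const

lemma dpred_unfold:
  "dpred1 K P \<longleftrightarrow> dpred K (\<lambda>v. P (v 0))"
  "dpred2 K Q \<longleftrightarrow> dpred K (\<lambda>v. Q (v 0) (v (Suc 0)))"
  "dpred3 K R \<longleftrightarrow> dpred K (\<lambda>v. R (v 0) (v (Suc 0)) (v (Suc (Suc 0))))"
  by (simp_all add: dpred1_def dpred2_def dpred3_def)

lemma set_in_U: "S x \<Longrightarrow> x \<in> U"
  using model unfolding model_of_def is_struct_def is_set_def by fastforce

lemma mem_in_U: "E x y \<Longrightarrow> x \<in> U \<and> y \<in> U"
  using model unfolding model_of_def is_struct_def mem_def by fastforce

lemma rel_length: "as \<in> rel K p \<Longrightarrow> length as = km_arity p"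
  using model unfolding model_of_def is_struct_def by fastforce

lemma asg_const: "\<exists>v. asg K v"
  using ne unfolding asg_def by (intro exI[where x = "\<lambda>_. SOME x. x \<in> U"]) (simp add: some_in_eq)

lemma in_KM:
  "km_sorts \<in> KM" "km_ext_sets \<in> KM" "km_ext_classes \<in> KM" "km_pairing \<in> KM" "km_union \<in> KM"
  "km_powerset \<in> KM" "km_foundation \<in> KM" "km_replacement \<in> KM"
  "X \<noteq> y \<Longrightarrow> X \<notin> fv \<phi> \<Longrightarrow> km_comprehension X y \<phi> \<in> KM"
  unfolding KM_def by blast+

lemma axiom: "\<phi> \<in> KM \<Longrightarrow> \<exists>v. asg K v \<and> sat K v \<phi>"
  using asg_const sat_KM by blast

text \<open>The propositional rules undo the encoding of the connectives.\<close>

lemma sat_unfold: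
  "sat K v (IsSet x) \<longleftrightarrow> S (v x)"
  "sat K v (Mem x y) \<longleftrightarrow> E (v x) (v y)"
  "\<not> (P \<and> \<not> Q) \<longleftrightarrow> (P \<longrightarrow> Q)"
  "(\<not> P \<longrightarrow> Q) \<longleftrightarrow> P \<or> Q"
  "(P \<longrightarrow> Q) \<and> (Q \<longrightarrow> P) \<longleftrightarrow> (P \<longleftrightarrow> Q)"
  "\<not> (\<forall>x\<in>A. \<not> R x) \<longleftrightarrow> (\<exists>x\<in>A. R x)"
  by (auto simp: is_set_def mem_def)

lemmas sat_simps = sat_unfold sat.simps(1,3,4,5)

lemma mem_set:
  assumes "E x y"
  shows "S x"
proof -
  have "\<forall>x\<in>U. \<forall>y\<in>U. E x y \<longrightarrow> S x"
    using axiom[OF in_KM(1)] unfolding km_sorts_def by (simp only: sat_simps; simp)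
  then show ?thesis using assms mem_in_U by blast
qed

lemma ext_sets:
  assumes "S x" "S y" "\<And>z. E z x \<longleftrightarrow> E z y"
  shows "x = y"
proof -
  have "\<forall>x\<in>U. S x \<longrightarrow> (\<forall>y\<in>U. S y \<longrightarrow> (\<forall>z\<in>U. S z \<longrightarrow> (E z x \<longleftrightarrow> E z y)) \<longrightarrow> x = y)"
    using axiom[OF in_KM(2)] unfolding km_ext_sets_def by (simp only: sat_simps; simp)
  then show ?thesis using assms set_in_U by blast
qed

lemma ext_classes:
  assumes "\<not> S x" "\<not> S y" "x \<in> U" "y \<in> U" "\<And>z. E z x \<longleftrightarrow> E z y"
  shows "x = y"
proof -
  have "\<forall>x\<in>U. \<not> S x \<longrightarrow> (\<forall>y\<in>U. \<not> S y \<longrightarrow> (\<forall>z\<in>U. S z \<longrightarrow> (E z x \<longleftrightarrow> E z y)) \<longrightarrow> x = y)"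
    using axiom[OF in_KM(3)] unfolding km_ext_classes_def by (simp only: sat_simps; simp)
  then show ?thesis using assms set_in_U by blast
qed

text \<open>The sorts must be compared as well: comprehension yields for each set a class with the
  same elements.\<close>

lemma ext:
  assumes "x \<in> U" "y \<in> U" "S x \<longleftrightarrow> S y" "\<And>z. E z x \<longleftrightarrow> E z y"
  shows "x = y"
proof (cases "S x")
  case True
  with assms show ?thesis by (intro ext_sets) simp_all
next
  case False
  with assms show ?thesis by (intro ext_classes) simp_all
qed

lemma pairing:
  assumes "S x" "S y"
  shows "\<exists>z. S z \<and> (\<forall>w. E w z \<longleftrightarrow> w = x \<or> w = y)"
proof -
  have "\<forall>x\<in>U. S x \<longrightarrow> (\<forall>y\<in>U. S y \<longrightarrow> (\<exists>z\<in>U. S z \<and> (\<forall>w\<in>U. S w \<longrightarrow> (E w z \<longleftrightarrow> w = x \<or> w = y))))"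
    using axiom[OF in_KM(4)] unfolding km_pairing_def by (simp only: sat_simps; simp)
  then obtain z where "S z" "\<forall>w\<in>U. S w \<longrightarrow> (E w z \<longleftrightarrow> w = x \<or> w = y)" using assms set_in_U by blast
  then show ?thesis using assms mem_set set_in_U by blast
qed

lemma union:
  assumes "S x"
  shows "\<exists>z. S z \<and> (\<forall>w. E w z \<longleftrightarrow> (\<exists>y. E y x \<and> E w y))"
proof -
  have "\<forall>x\<in>U. S x \<longrightarrow> (\<exists>z\<in>U. S z \<and> (\<forall>w\<in>U. S w \<longrightarrow> (E w z \<longleftrightarrow> (\<exists>y\<in>U. S y \<and> E y x \<and> E w y))))"
    using axiom[OF in_KM(5)] unfolding km_union_def by (simp only: sat_simps; simp)
  then obtain z where "S z" "\<forall>w\<in>U. S w \<longrightarrow> (E w z \<longleftrightarrow> (\<exists>y\<in>U. S y \<and> E y x \<and> E w y))" using assms set_in_U by blast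
  then show ?thesis using mem_set set_in_U by blast
qed

lemma powerset:
  assumes "S x"
  shows "\<exists>z. S z \<and> (\<forall>w. E w z \<longleftrightarrow> S w \<and> (\<forall>y. E y w \<longrightarrow> E y x))"
proof -
  have "\<forall>x\<in>U. S x \<longrightarrow> (\<exists>z\<in>U. S z \<and> (\<forall>w\<in>U. S w \<longrightarrow> (E w z \<longleftrightarrow> (\<forall>y\<in>U. S y \<longrightarrow> E y w \<longrightarrow> E y x))))"
    using axiom[OF in_KM(6)] unfolding km_powerset_def by (simp only: sat_simps; simp)
  then obtain z where z: "S z"
    "\<forall>w\<in>U. S w \<longrightarrow> (E w z \<longleftrightarrow> (\<forall>y\<in>U. S y \<longrightarrow> E y w \<longrightarrow> E y x))"
    using assms set_in_U[OF assms] by blast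
  have "E y w \<longrightarrow> y \<in> U \<and> S y" for y w
    using mem_set[of y w] mem_in_U[of y w] by blast
  then have "E w z \<longleftrightarrow> S w \<and> (\<forall>y. E y w \<longrightarrow> E y x)" for w
    using z(2) set_in_U[of w] by metis
  then show ?thesis using z(1) by blast
qed

lemma class_foundation:
  assumes "X \<in> U" "\<not> S X" "E x X"
  shows "\<exists>x. E x X \<and> (\<forall>y. E y x \<longrightarrow> \<not> E y X)"
proof -
  have "\<forall>X\<in>U. \<not> S X \<longrightarrow> (\<exists>x\<in>U. S x \<and> E x X) \<longrightarrow>
    (\<exists>x\<in>U. S x \<and> E x X \<and> (\<forall>y\<in>U. S y \<longrightarrow> E y x \<longrightarrow> \<not> E y X))"
    using axiom[OF in_KM(7)] unfolding km_foundation_def by (simp only: sat_simps; simp)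
  moreover have "\<exists>x\<in>U. S x \<and> E x X"
    using assms(3) mem_set[OF assms(3)] mem_in_U[OF assms(3)] by blast
  ultimately have "\<exists>x\<in>U. S x \<and> E x X \<and> (\<forall>y\<in>U. S y \<longrightarrow> E y x \<longrightarrow> \<not> E y X)"
    using assms(1,2) by simp
  then obtain z where "z \<in> U" "S z" "E z X" and z: "\<forall>y\<in>U. S y \<longrightarrow> E y z \<longrightarrow> \<not> E y X"
    by blast
  moreover have "\<not> E y X" if "E y z" for y
    using z that mem_set[OF that] mem_in_U[OF that] by blast
  ultimately show ?thesis by blast
qed

lemma comprehension:
  assumes "dpred1 K P"
  shows "\<exists>X\<in>U. \<not> S X \<and> (\<forall>y. E y X \<longleftrightarrow> S y \<and> P y)"
proof -
  obtain n e \<phi> where n: "n \<ge> 1" and e: "asg K e"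
    and P: "\<forall>v. asg K v \<longrightarrow> P (v 0) = sat K (\<lambda>i. if i < n then v i else e i) \<phi>"
    using dpred_weaken[OF assms[unfolded dpred1_def]] .
  \<comment> \<open>The variable for the new class has to avoid the argument 0 and all free
    variables of \<open>\<phi>\<close>.\<close>
  have "finite (insert 0 (fv \<phi>))" by (simp add: finite_fv)
  then obtain X where X: "X \<noteq> 0" "X \<notin> fv \<phi>"
    using ex_new_if_finite[OF infinite_UNIV_nat] by blast
  have "sat K e (km_comprehension X 0 \<phi>)"
    using sat_KM[OF in_KM(9)[OF X] e] .
  then have "\<exists>c\<in>U. \<not> S c \<and> (\<forall>y\<in>U. S y \<longrightarrow> (E y c \<longleftrightarrow> sat K (e(X := c, 0 := y)) \<phi>))"
    unfolding km_comprehension_def using X(1) by (simp only: sat_simps; simp)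
  then obtain c where c: "c \<in> U" "\<not> S c"
    and "\<forall>y\<in>U. S y \<longrightarrow> (E y c \<longleftrightarrow> sat K (e(X := c, 0 := y)) \<phi>)"
    by blast
  moreover have "sat K (e(X := c, 0 := y)) \<phi> \<longleftrightarrow> P y" if "y \<in> U" for y
  proof -
    \<comment> \<open>Only the value at 0 matters to \<open>P\<close>, so all other arguments may be
      given the values of \<open>e\<close>.\<close>
    have "asg K (e(0 := y))" using e that by (simp add: asg_def)
    then have "P y = sat K (\<lambda>i. if i < n then (e(0 := y)) i else e i) \<phi>"
      using P[rule_format, of "e(0 := y)"] by simp
    also have "\<dots> = sat K (e(X := c, 0 := y)) \<phi>"
      by (rule sat_cong_fv) (use X n in auto)
    finally show ?thesis by simp
  qed
  ultimately have "\<forall>y. E y c \<longleftrightarrow> S y \<and> P y"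
    using mem_set[of _ c] set_in_U by metis
  with c show ?thesis by blast
qed

text \<open>A counterexample makes the class of all counterexamples nonempty, and foundation gives a
  minimal one. As comprehension is impredicative, \<open>P\<close> may quantify over
  classes.\<close>

lemma induct:
  assumes "dpred1 K P" and step: "\<And>x. S x \<Longrightarrow> (\<And>y. E y x \<Longrightarrow> P y) \<Longrightarrow> P x"
    and "S x"
  shows "P x"
proof (rule ccontr)
  assume x: "\<not> P x"
  have "dpred1 K (\<lambda>x. \<not> P x)" using assms(1) unfolding dpred1_def by (rule dpred_not)
  then obtain X where X: "X \<in> U" "\<not> S X" "\<forall>y. E y X \<longleftrightarrow> S y \<and> \<not> P y"
    using comprehension by blast
  moreover have "E x X" using X(3) x \<open>S x\<close> by blast
  ultimately obtain z where z: "E z X" "\<forall>y. E y z \<longrightarrow> \<not> E y X"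
    using class_foundation by blast
  have "P y" if "E y z" for y
    using z(2) X(3) that mem_set[OF that] by blast
  then have "P z" using step[of z] X(3) z(1) by blast
  then show False using X(3) z(1) by blast
qed

lemma not_mem_self: "\<not> E x x"
proof
  assume x: "E x x"
  have "dpred1 K (\<lambda>y. \<not> y = x)"
    unfolding dpred_unfold by (intro dpred_rules) (use mem_in_U[OF x] in simp)
  then have "\<not> x = x"
  proof (rule induct)
    show "S x" by (rule mem_set[OF x])
    show "\<not> y = x" if "\<And>z. E z y \<Longrightarrow> \<not> z = x" for y
      using that[of x] x by blast
  qed
  then show False by simp
qed

section \<open>Ordered pairs and relations coded by classes\<close>

definition upair :: "'a \<Rightarrow> 'a \<Rightarrow> 'a \<Rightarrow> bool" where
  "upair z x y \<longleftrightarrow> S z \<and> (\<forall>w\<in>U. E w z \<longleftrightarrow> w = x \<or> w = y)"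

definition opair :: "'a \<Rightarrow> 'a \<Rightarrow> 'a \<Rightarrow> bool" where
  "opair p x y \<longleftrightarrow> S p \<and> (\<forall>w\<in>U. E w p \<longleftrightarrow> upair w x x \<or> upair w x y)"

lemma upair_ex:
  assumes "S x" "S y"
  shows "\<exists>z. upair z x y"
  using pairing[OF assms] unfolding upair_def by blast

lemma ext_sets_bounded:
  assumes "S x" "S y" "\<forall>z\<in>U. E z x \<longleftrightarrow> E z y"
  shows "x = y"
proof (rule ext_sets[OF assms(1,2)])
  fix z show "E z x \<longleftrightarrow> E z y"
    using assms(3) mem_in_U[of z x] mem_in_U[of z y] by blast
qed

lemma upair_unique: "upair z x y \<Longrightarrow> upair z' x y \<Longrightarrow> z = z'"
  by (rule ext_sets_bounded) (simp_all add: upair_def)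

lemma upair_inject:
  assumes "upair z x y" "upair z x' y'" "S x" "S y" "S x'" "S y'"
  shows "x = x' \<and> y = y' \<or> x = y' \<and> y = x'"
proof -
  have iff: "w = x \<or> w = y \<longleftrightarrow> w = x' \<or> w = y'" if "S w" for w
    using assms(1,2) set_in_U[OF that] unfolding upair_def by blast
  show ?thesis using iff[OF assms(3)] iff[OF assms(4)] iff[OF assms(5)] iff[OF assms(6)] by auto
qed

lemma upair_in_U: "upair z x y \<Longrightarrow> z \<in> U"
  by (simp add: upair_def set_in_U)

lemma opair_ex:
  assumes "S x" "S y"
  shows "\<exists>p. opair p x y"
proof -
  obtain a where a: "upair a x x" using upair_ex[OF assms(1,1)] by blast
  obtain b where b: "upair b x y" using upair_ex[OF assms] by blast
  obtain p where p: "upair p a b" using upair_ex[of a b] a b unfolding upair_def by blast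
  have "upair w x x \<longleftrightarrow> w = a" "upair w x y \<longleftrightarrow> w = b" for w
    using a b upair_unique by blast+
  then have "opair p x y"
    using p unfolding opair_def upair_def[of p] by simp
  then show ?thesis ..
qed

lemma opair_inject:
  assumes p: "opair p x y" "opair p x' y'" and S: "S x" "S y" "S x'" "S y'"
  shows "x = x' \<and> y = y'"
proof -
  obtain a where a: "upair a x x" using upair_ex S by blast
  obtain b where b: "upair b x y" using upair_ex S by blast
  obtain a' where a': "upair a' x' x'" using upair_ex S by blast
  obtain b' where b': "upair b' x' y'" using upair_ex S by blast
  note u = a b a' b'
  have U: "a \<in> U" "b \<in> U" "a' \<in> U" "b' \<in> U"
    using u by (auto dest: upair_in_U)
  have iff: "upair w x x \<or> upair w x y \<longleftrightarrow> upair w x' x' \<or> upair w x' y'" if "w \<in> U" for w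
    using p that unfolding opair_def by blast
  have "x = x'"
    using iff[OF U(1)] u(1) upair_inject[of a x x] S by blast
  moreover have "y = y'"
  proof (cases "y = x")
    case True
    then have "upair b' x x" using iff[OF U(4)] u(4) by blast
    then show ?thesis using upair_inject[OF u(4)] S True \<open>x = x'\<close> by blast
  next
    case False
    have "upair b x' x' \<or> upair b x' y'" using iff[OF U(2)] u(2) by blast
    then show ?thesis
      using upair_inject[OF u(2), of x' x'] upair_inject[OF u(2), of x' y'] S False \<open>x = x'\<close> by blast
  qed
  ultimately show ?thesis ..
qed

lemma opair_set: "opair p x y \<Longrightarrow> S p"
  by (simp add: opair_def)

lemma dpred3_upair: "dpred3 K upair"
  unfolding dpred_unfold upair_def by (intro dpred_rules)

lemma dpred3_opair: "dpred3 K opair"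
  unfolding dpred_unfold opair_def by (intro dpred_rules dpred3_app[OF dpred3_upair])

definition coded :: "'a \<Rightarrow> 'a \<Rightarrow> 'a \<Rightarrow> bool" where
  "coded p x y \<longleftrightarrow> (\<exists>q\<in>U. opair q x y \<and> E q p)"

lemma dpred3_coded: "dpred3 K coded"
  unfolding dpred_unfold coded_def by (intro dpred_rules dpred3_app[OF dpred3_opair])

text \<open>This lets a quantifier over the objects of \<open>K\<close> stand for one over all
  definable relations between sets.\<close>

lemma coding_class:
  assumes H: "dpred2 K H"
  shows "\<exists>p\<in>U. \<not> S p \<and> (\<forall>x y. S x \<longrightarrow> S y \<longrightarrow> (coded p x y \<longleftrightarrow> H x y))"
proof -
  define P where "P p \<longleftrightarrow> (\<exists>x\<in>U. \<exists>y\<in>U. S x \<and> S y \<and> opair p x y \<and> H x y)" for p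
  have "dpred1 K P"
    unfolding dpred_unfold P_def
    by (intro dpred_rules dpred3_app[OF dpred3_opair] dpred2_app[OF H])
  then obtain X where X: "X \<in> U" "\<forall>p. E p X \<longleftrightarrow> S p \<and> P p" and "\<not> S X"
    using comprehension by blast
  have "coded X x y \<longleftrightarrow> H x y" if S: "S x" "S y" for x y
  proof
    assume "coded X x y"
    then obtain p x' y' where "opair p x y" "opair p x' y'" "S x'" "S y'" "H x' y'"
      unfolding coded_def X(2)[rule_format] P_def by blast
    then show "H x y" using opair_inject S by blast
  next
    assume H: "H x y"
    obtain p where p: "opair p x y" using opair_ex[OF S] by blast
    have "P p" using H p S set_in_U[OF S(1)] set_in_U[OF S(2)] unfolding P_def by blast
    then show "coded X x y"
      unfolding coded_def X(2)[rule_format] using p opair_set[OF p] set_in_U by blast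
  qed
  with X(1) \<open>\<not> S X\<close> show ?thesis by blast
qed

lemma coding:
  assumes "dpred2 K H"
  shows "\<exists>p\<in>U. \<forall>x y. S x \<longrightarrow> S y \<longrightarrow> (coded p x y \<longleftrightarrow> H x y)"
  using coding_class[OF assms] by (elim bexE conjE) (rule bexI)

lemma sat_Opair:
  assumes "asg K v" "10 \<notin> {p, x, y}" "11 \<notin> {p, x, y}" "S (v p)" "S (v x)" "S (v y)"
  shows "sat K v (Opair p x y) \<longleftrightarrow> opair (v p) (v x) (v y)"
proof -
  have "sat K v (Opair p x y) \<longleftrightarrow>
    (\<forall>q\<in>U. S q \<longrightarrow> (E q (v p) \<longleftrightarrow> (\<forall>w\<in>U. S w \<longrightarrow> (E w q \<longleftrightarrow> w = v x \<or> w = v x)) \<or> (\<forall>w\<in>U. S w \<longrightarrow> (E w q \<longleftrightarrow> w = v x \<or> w = v y))))"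
    using assms unfolding Opair_def Upair_def by (simp only: sat_simps; simp)
  also have "\<dots> \<longleftrightarrow> (\<forall>q\<in>U. S q \<longrightarrow> (E q (v p) \<longleftrightarrow> upair q (v x) (v x) \<or> upair q (v x) (v y)))"
  proof -
    have *: "(\<forall>w\<in>U. S w \<longrightarrow> (E w q \<longleftrightarrow> w = v x \<or> w = b)) \<longleftrightarrow> upair q (v x) b" if "S q" "S b" for q b
      unfolding upair_def using that assms(5) set_in_U mem_set by blast
    show ?thesis by (simp only: * assms(5,6) cong: imp_cong)
  qed
  also have "\<dots> \<longleftrightarrow> opair (v p) (v x) (v y)"
    unfolding opair_def upair_def using assms(4) set_in_U mem_set by blast
  finally show ?thesis .
qed

text \<open>The axiom speaks of class functions built from Kuratowski pairs, so \<open>H\<close> is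
  first turned into a class of such pairs.\<close>

lemma replacement:
  assumes H: "dpred2 K H" and c: "S c"
    and fn: "\<And>x y y'. S x \<Longrightarrow> S y \<Longrightarrow> S y' \<Longrightarrow> H x y \<Longrightarrow> H x y' \<Longrightarrow> y = y'"
  shows "\<exists>d. S d \<and> (\<forall>y. E y d \<longleftrightarrow> S y \<and> (\<exists>x. E x c \<and> H x y))"
proof -
  obtain X where X: "X \<in> U" "\<not> S X" and code: "\<forall>x y. S x \<longrightarrow> S y \<longrightarrow> (coded X x y \<longleftrightarrow> H x y)"
    using coding_class[OF H] by (elim bexE conjE)
  have in_X: "(\<exists>p. S p \<and> opair p x y \<and> E p X) \<longleftrightarrow> H x y" if "S x" "S y" for x y
  proof -
    have "(\<exists>p. S p \<and> opair p x y \<and> E p X) \<longleftrightarrow> coded X x y"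
      unfolding coded_def using opair_set set_in_U by blast
    then show ?thesis using code that by simp
  qed
  have OpairIn: "sat K v (OpairIn x y F) \<longleftrightarrow> (\<exists>p. S p \<and> opair p (v x) (v y) \<and> E p (v F))"
    if "asg K v" and "{x, y, F} \<inter> {10, 11, 12} = {}" and "S (v x)" and "S (v y)" for v x y F
  proof -
    have "sat K v (OpairIn x y F) \<longleftrightarrow> (\<exists>p\<in>U. S p \<and> sat K (v(12 := p)) (Opair 12 x y) \<and> E p (v F))"
      unfolding OpairIn_def using that(2) by (simp only: sat_simps; simp)
    also have "\<dots> \<longleftrightarrow> (\<exists>p. S p \<and> opair p (v x) (v y) \<and> E p (v F))"
    proof -
      have "sat K (v(12 := p)) (Opair 12 x y) \<longleftrightarrow> opair p (v x) (v y)" if p: "S p" for p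
        using sat_Opair[of "v(12 := p)" 12 x y] \<open>asg K v\<close> \<open>{x, y, F} \<inter> {10, 11, 12} = {}\<close>
          \<open>S (v x)\<close> \<open>S (v y)\<close> p set_in_U[OF p] by (simp add: asg_def)
      then show ?thesis using set_in_U by blast
    qed
    finally show ?thesis .
  qed
  obtain v where v: "asg K v" "sat K v km_replacement" using axiom[OF in_KM(8)] by blast
  let ?O = "\<lambda>x y X. \<exists>p. S p \<and> opair p x y \<and> E p X"
  have "\<forall>X\<in>U. \<not> S X \<longrightarrow>
    (\<forall>x\<in>U. S x \<longrightarrow> (\<forall>y\<in>U. S y \<longrightarrow> (\<forall>y'\<in>U. S y' \<longrightarrow> ?O x y X \<and> ?O x y' X \<longrightarrow> y = y'))) \<longrightarrow>
    (\<forall>c\<in>U. S c \<longrightarrow> (\<exists>d\<in>U. S d \<and> (\<forall>y\<in>U. S y \<longrightarrow> (E y d \<longleftrightarrow> (\<exists>x\<in>U. S x \<and> E x c \<and> ?O x y X)))))"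
    using v unfolding km_replacement_def
    by (simp only: sat_simps; simp add: OpairIn asg_def cong: conj_cong)
  moreover have "\<forall>x\<in>U. S x \<longrightarrow> (\<forall>y\<in>U. S y \<longrightarrow> (\<forall>y'\<in>U. S y' \<longrightarrow> ?O x y X \<and> ?O x y' X \<longrightarrow> y = y'))"
    using in_X fn by blast
  ultimately have "\<forall>c\<in>U. S c \<longrightarrow> (\<exists>d\<in>U. S d \<and> (\<forall>y\<in>U. S y \<longrightarrow> (E y d \<longleftrightarrow> (\<exists>x\<in>U. S x \<and> E x c \<and> ?O x y X))))"
    using X(1,2) by simp
  then have "\<exists>d\<in>U. S d \<and> (\<forall>y\<in>U. S y \<longrightarrow> (E y d \<longleftrightarrow> (\<exists>x\<in>U. S x \<and> E x c \<and> ?O x y X)))"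
    using c set_in_U[OF c] by simp
  then obtain d where d: "S d" "\<forall>y\<in>U. S y \<longrightarrow> (E y d \<longleftrightarrow> (\<exists>x\<in>U. S x \<and> E x c \<and> ?O x y X))"
    by (elim bexE conjE)
  have "E x c \<longrightarrow> x \<in> U \<and> S x" for x
    using mem_set[of x c] mem_in_U[of x c] by blast
  then have "E y d \<longleftrightarrow> (\<exists>x. E x c \<and> H x y)" if "S y" for y
    using d(2) that set_in_U[OF that] in_X[of _ y] by metis
  then have "E y d \<longleftrightarrow> S y \<and> (\<exists>x. E x c \<and> H x y)" for y
    using mem_set[of y d] by blast
  with d(1) show ?thesis by blast
qed


text \<open>Replacement for the identity restricted to \<open>P\<close>, a partial function.\<close>

lemma separation:
  assumes P: "dpred1 K P" and c: "S c"
  shows "\<exists>d. S d \<and> (\<forall>y. E y d \<longleftrightarrow> E y c \<and> P y)"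
proof -
  have "dpred2 K (\<lambda>x y. x = y \<and> P y)"
    unfolding dpred_unfold by (intro dpred_rules dpred1_app[OF P])
  then obtain d where d: "S d" "\<forall>y. E y d \<longleftrightarrow> S y \<and> (\<exists>x. E x c \<and> x = y \<and> P y)"
    using replacement[OF _ c, of "\<lambda>x y. x = y \<and> P y"] by auto
  have "E y d \<longleftrightarrow> E y c \<and> P y" for y
    using d(2) mem_set[of y c] by blast
  with d(1) show ?thesis by blast
qed

section \<open>Comparison of ranks\<close>

text \<open>The comparison of ranks is the least relation \<open>R\<close> such that \<open>u R x\<close> holds whenever every
  element of \<open>u\<close> is related to some element of \<open>x\<close>. Classes code relations on sets, so that it is
  definable.\<close>

definition progressive :: "'a \<Rightarrow> bool" where
  "progressive p \<longleftrightarrow> (\<forall>u\<in>U. \<forall>x\<in>U. S u \<longrightarrow> S x \<longrightarrow>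
     (\<forall>u'\<in>U. E u' u \<longrightarrow> (\<exists>x'\<in>U. E x' x \<and> coded p u' x')) \<longrightarrow> coded p u x)"

definition rank_le :: "'a \<Rightarrow> 'a \<Rightarrow> bool" where
  "rank_le u x \<longleftrightarrow> S u \<and> S x \<and> (\<forall>p\<in>U. progressive p \<longrightarrow> coded p u x)"

lemma dpred1_progressive: "dpred1 K progressive"
  unfolding dpred_unfold progressive_def by (intro dpred_rules dpred3_app[OF dpred3_coded])

lemma dpred2_rank_le: "dpred2 K rank_le"
  unfolding dpred_unfold rank_le_def
  by (intro dpred_rules dpred3_app[OF dpred3_coded] dpred1_app[OF dpred1_progressive])

lemma rank_le_set: "rank_le u x \<Longrightarrow> S u \<and> S x"
  by (simp add: rank_le_def)

text \<open>An intersection of relations closed under a monotone rule is itself closed under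
  it.\<close>

lemma rank_leI:
  assumes S: "S u" "S x" and *: "\<And>u'. E u' u \<Longrightarrow> \<exists>x'. E x' x \<and> rank_le u' x'"
  shows "rank_le u x"
proof -
  have "coded p u x" if p: "p \<in> U" "progressive p" for p
  proof -
    have "\<exists>x'\<in>U. E x' x \<and> coded p u' x'" if u': "E u' u" for u'
    proof -
      obtain x' where "E x' x" "rank_le u' x'" using *[OF u'] by blast
      then show ?thesis using p mem_in_U[of x' x] unfolding rank_le_def by blast
    qed
    then show ?thesis
      using p(2) S set_in_U[OF S(1)] set_in_U[OF S(2)] unfolding progressive_def by blast
  qed
  then show ?thesis using S unfolding rank_le_def by blast
qed

text \<open>Inversion for a least fixed point: unfolding \<open>rank_le\<close> once gives a
  relation \<open>H\<close> that is again progressive and so contains \<open>rank_le\<close>. Coding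
  \<open>H\<close> requires impredicative comprehension, because \<open>rank_le\<close> quantifies
  over classes.\<close>

lemma rank_leD:
  assumes "rank_le u x" "E u' u"
  shows "\<exists>x'. E x' x \<and> rank_le u' x'"
proof -
  define H where "H u x \<longleftrightarrow> (\<forall>u'\<in>U. E u' u \<longrightarrow> (\<exists>x'\<in>U. E x' x \<and> rank_le u' x'))" for u x
  have "dpred2 K H"
    unfolding dpred_unfold H_def by (intro dpred_rules dpred2_app[OF dpred2_rank_le])
  then obtain p where p: "p \<in> U" "\<forall>x y. S x \<longrightarrow> S y \<longrightarrow> coded p x y \<longleftrightarrow> H x y"
    using coding by blast
  have "coded p u x" if S: "S u" "S x" and
    *: "\<forall>u'\<in>U. E u' u \<longrightarrow> (\<exists>x'\<in>U. E x' x \<and> coded p u' x')" for u x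
  proof -
    have "\<exists>x'\<in>U. E x' x \<and> rank_le u' x'" if u': "u' \<in> U" "E u' u" for u'
    proof -
      obtain x' where x': "x' \<in> U" "E x' x" "coded p u' x'" using * u' by blast
      have S': "S u'" "S x'" using mem_set[OF u'(2)] mem_set[OF x'(2)] .
      then have "H u' x'" using p(2) x'(3) by blast
      then have "rank_le u' x'" by (intro rank_leI S') (use mem_in_U in \<open>auto simp: H_def\<close>)
      then show ?thesis using x' by blast
    qed
    then have "H u x" unfolding H_def by blast
    then show ?thesis using p(2) S by blast
  qed
  then have "progressive p" unfolding progressive_def by blast
  then have "H u x" using assms(1) p rank_le_set[OF assms(1)] unfolding rank_le_def by blast
  then show ?thesis using assms(2) mem_in_U[OF assms(2)] unfolding H_def by blast
qed

text \<open>Induction on \<open>x\<close>: if an element of \<open>x\<close> is below no element of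
  \<open>y\<close>, then by hypothesis all elements of \<open>y\<close> are below that one element,
  and \<open>y\<close> is below \<open>x\<close>.\<close>

lemma rank_le_linear:
  assumes "S x" "S y"
  shows "rank_le x y \<or> rank_le y x"
proof -
  define P where "P x \<longleftrightarrow> (\<forall>y\<in>U. S y \<longrightarrow> rank_le x y \<or> rank_le y x)" for x
  have "dpred1 K P"
    unfolding dpred_unfold P_def by (intro dpred_rules dpred2_app[OF dpred2_rank_le])
  then have "P x"
  proof (rule induct[OF _ _ assms(1)])
    fix x assume x: "S x" and IH: "\<And>x'. E x' x \<Longrightarrow> P x'"
    have "rank_le x y \<or> rank_le y x" if y: "S y" for y
    proof (cases "\<exists>x'. E x' x \<and> (\<forall>y'. E y' y \<longrightarrow> \<not> rank_le x' y')")
      case True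
      then obtain x' where x': "E x' x" "\<And>y'. E y' y \<Longrightarrow> \<not> rank_le x' y'" by blast
      have "rank_le y' x'" if y': "E y' y" for y'
        using IH[OF x'(1)] x'(2)[OF y'] mem_set[OF y'] mem_in_U[OF y'] unfolding P_def by blast
      then have "rank_le y x" using x' by (intro rank_leI[OF y x]) blast
      then show ?thesis ..
    next
      case False
      then have "rank_le x y" by (intro rank_leI[OF x y]) blast
      then show ?thesis ..
    qed
    then show "P x" unfolding P_def by blast
  qed
  then show ?thesis using assms(2) set_in_U[OF assms(2)] unfolding P_def by blast
qed

text \<open>To avoid choosing bounds, separation trims each bound to the set of exactly those
  \<open>u\<close> that are below the given element. This set is unique, so replacement and union
  apply.\<close>

lemma rank_le_bound_elems:
  assumes x: "S x" and b: "\<And>x'. E x' x \<Longrightarrow> \<exists>b. S b \<and> (\<forall>u. rank_le u x' \<longrightarrow> E u b)"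
  shows "\<exists>c. S c \<and> (\<forall>x' u. E x' x \<longrightarrow> rank_le u x' \<longrightarrow> E u c)"
proof -
  define H where "H y d \<longleftrightarrow> S d \<and> (\<forall>u\<in>U. E u d \<longleftrightarrow> rank_le u y)" for y d
  have H: "dpred2 K H"
    unfolding dpred_unfold H_def by (intro dpred_rules dpred2_app[OF dpred2_rank_le])
  have "d = d'" if "H y d" "H y d'" for y d d'
    using that unfolding H_def by (intro ext_sets_bounded) auto
  then obtain r where r: "S r" "\<forall>d. E d r \<longleftrightarrow> S d \<and> (\<exists>y. E y x \<and> H y d)"
    using replacement[OF H x] by blast
  obtain c where c: "S c" "\<forall>w. E w c \<longleftrightarrow> (\<exists>y. E y r \<and> E w y)"
    using union[OF r(1)] by blast
  have "E u c" if x': "E x' x" and u: "rank_le u x'" for x' u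
  proof -
    obtain b where b: "S b" "\<forall>u. rank_le u x' \<longrightarrow> E u b" using b[OF x'] by blast
    have "dpred1 K (\<lambda>u. rank_le u x')"
      unfolding dpred_unfold using mem_in_U[OF x'] by (intro dpred_rules dpred2_app[OF dpred2_rank_le]) auto
    then obtain d where d: "S d" "\<forall>u. E u d \<longleftrightarrow> E u b \<and> rank_le u x'"
      using separation[OF _ b(1)] by blast
    have "H x' d" using d b unfolding H_def by blast
    then have "E d r" using r(2) d(1) x' by blast
    moreover have "E u d" using d(2) b(2) u by blast
    ultimately show ?thesis using c(2) by blast
  qed
  then show ?thesis using c(1) by blast
qed

text \<open>As in the cumulative hierarchy, \<open>c\<close> collects whatever is below an element
  of \<open>x\<close>; a set below \<open>x\<close> is then a subset of \<open>c\<close>, hence an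
  element of its power set.\<close>

lemma rank_le_bound:
  assumes "S x"
  shows "\<exists>b. S b \<and> (\<forall>u. rank_le u x \<longrightarrow> E u b)"
proof -
  define P where "P x \<longleftrightarrow> (\<exists>b\<in>U. S b \<and> (\<forall>u\<in>U. rank_le u x \<longrightarrow> E u b))" for x
  have P: "(\<exists>b. S b \<and> (\<forall>u. rank_le u x \<longrightarrow> E u b)) \<longleftrightarrow> P x" for x
  proof -
    have "rank_le u x \<longrightarrow> u \<in> U" for u
      using rank_le_set[of u x] set_in_U[of u] by blast
    moreover have "S b \<longrightarrow> b \<in> U" for b using set_in_U by blast
    ultimately show ?thesis unfolding P_def by meson
  qed
  have "dpred1 K P"
    unfolding dpred_unfold P_def by (intro dpred_rules dpred2_app[OF dpred2_rank_le])
  then have "P x"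
  proof (rule induct[OF _ _ assms])
    fix x assume x: "S x" and IH: "\<And>x'. E x' x \<Longrightarrow> P x'"
    obtain c where c: "S c" "\<forall>x' u. E x' x \<longrightarrow> rank_le u x' \<longrightarrow> E u c"
      using rank_le_bound_elems[OF x] IH unfolding P[symmetric] by blast
    obtain b where b: "S b" "\<forall>w. E w b \<longleftrightarrow> S w \<and> (\<forall>y. E y w \<longrightarrow> E y c)"
      using powerset[OF c(1)] by blast
    have "E u b" if u: "rank_le u x" for u
    proof -
      have "E u' c" if "E u' u" for u'
        using rank_leD[OF u that] c(2) by blast
      then show ?thesis using b(2) rank_le_set[OF u] by blast
    qed
    then show "P x" unfolding P[symmetric] using b(1) by blast
  qed
  then show ?thesis unfolding P .
qed

lemma rank_le_bound_below:
  assumes "S x"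
  shows "\<exists>c. S c \<and> (\<forall>x' u. E x' x \<longrightarrow> rank_le u x' \<longrightarrow> E u c)"
  using rank_le_bound_elems[OF assms] rank_le_bound mem_set by blast


section \<open>Partial functions with arbitrary values\<close>

text \<open>A class can only code a relation between sets, so a partial function from sets to arbitrary
  objects is coded by three classes: the elements of its values, the places where the value is a
  set, and its domain.\<close>

definition fcode :: "'a \<Rightarrow> 'a \<Rightarrow> 'a \<Rightarrow> 'a \<Rightarrow> 'a \<Rightarrow> bool" where
  "fcode p q r x y \<longleftrightarrow> coded r x x \<and> (S y \<longleftrightarrow> coded q x x) \<and>
     (\<forall>z\<in>U. S z \<longrightarrow> (E z y \<longleftrightarrow> coded p x z))"

lemma dpred_fcode:
  assumes "dterm K p" "dterm K q" "dterm K r" "dterm K x" "dterm K y"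
  shows "dpred K (\<lambda>v. fcode (p v) (q v) (r v) (x v) (y v))"
proof -
  define T where "T i = (if i = 0 then p else if i = 1 then q else if i = 2 then r
    else if i = 3 then x else y)" for i :: nat
  have "dpred K (\<lambda>v. fcode (v 0) (v 1) (v 2) (v 3) (v 4))"
    unfolding fcode_def by (intro dpred_rules dpred3_app[OF dpred3_coded])
  then have "dpred K (\<lambda>v. fcode (T 0 v) (T 1 v) (T 2 v) (T 3 v) (T 4 v))"
    by (rule dpred_subst) (use assms in \<open>simp add: T_def\<close>)
  then show ?thesis by (simp add: T_def)
qed

lemma ext_bounded:
  assumes "x \<in> U" "y \<in> U" "S x \<longleftrightarrow> S y" "\<And>z. z \<in> U \<Longrightarrow> S z \<Longrightarrow> E z x \<longleftrightarrow> E z y"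
  shows "x = y"
proof (rule ext[OF assms(1-3)])
  fix z show "E z x \<longleftrightarrow> E z y"
    using assms(4)[of z] mem_in_U[of z x] mem_in_U[of z y] mem_set[of z x] mem_set[of z y] by blast
qed

text \<open>Since \<open>H\<close> is functional, the elements and the sort of "some value" at
  \<open>x\<close> are those of the only value, which extensionality recovers from them.\<close>

lemma fcoding:
  assumes H: "dpred2 K H"
    and fn: "\<And>x y y'. S x \<Longrightarrow> y \<in> U \<Longrightarrow> y' \<in> U \<Longrightarrow> H x y \<Longrightarrow> H x y' \<Longrightarrow> y = y'"
  shows "\<exists>p\<in>U. \<exists>q\<in>U. \<exists>r\<in>U. \<forall>x y. S x \<longrightarrow> y \<in> U \<longrightarrow> (fcode p q r x y \<longleftrightarrow> H x y)"
proof -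
  have "dpred2 K (\<lambda>x z. \<exists>y\<in>U. H x y \<and> E z y)" "dpred2 K (\<lambda>x z. \<exists>y\<in>U. H x y \<and> S y)"
    "dpred2 K (\<lambda>x z. \<exists>y\<in>U. H x y)"
    unfolding dpred_unfold by (intro dpred_rules dpred2_app[OF H])+
  from this[THEN coding] obtain p q r where U: "p \<in> U" "q \<in> U" "r \<in> U"
    and p: "\<And>x z. S x \<Longrightarrow> S z \<Longrightarrow> coded p x z \<longleftrightarrow> (\<exists>y\<in>U. H x y \<and> E z y)"
    and q: "\<And>x z. S x \<Longrightarrow> S z \<Longrightarrow> coded q x z \<longleftrightarrow> (\<exists>y\<in>U. H x y \<and> S y)"
    and r: "\<And>x z. S x \<Longrightarrow> S z \<Longrightarrow> coded r x z \<longleftrightarrow> (\<exists>y\<in>U. H x y)"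
    by (elim bexE) simp
  have "fcode p q r x y \<longleftrightarrow> H x y" if x: "S x" and y: "y \<in> U" for x y
  proof
    assume f: "fcode p q r x y"
    then obtain y0 where y0: "y0 \<in> U" "H x y0"
      using r[OF x x] unfolding fcode_def by blast
    have *: "(\<exists>y\<in>U. H x y \<and> Q y) \<longleftrightarrow> Q y0" for Q
      using y0 fn[OF x _ y0(1) _ y0(2)] by blast
    have "y = y0"
      using f p[OF x] q[OF x x] unfolding fcode_def * by (intro ext_bounded[OF y y0(1)]) auto
    then show "H x y" using y0(2) by simp
  next
    assume h: "H x y"
    have *: "(\<exists>y\<in>U. H x y \<and> Q y) \<longleftrightarrow> Q y" for Q
      using h y fn[OF x _ y _ h] by blast
    show "fcode p q r x y"
      using h y p[OF x] q[OF x x] r[OF x x] unfolding fcode_def * by auto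
  qed
  with U show ?thesis by blast
qed

section \<open>Cantor's theorem for two-to-one maps\<close>

text \<open>The relation \<open>k\<close> is to be an injection on the sets satisfying \<open>A\<close> as well as on the others;
  the images of the two parts of a collection of sets are then coded by an ordered pair.\<close>

definition diagonal :: "('a \<Rightarrow> 'a \<Rightarrow> bool) \<Rightarrow> ('a \<Rightarrow> bool) \<Rightarrow> 'a \<Rightarrow> bool" where
  "diagonal k A u \<longleftrightarrow> S u \<and> (\<exists>a\<in>U. \<exists>b\<in>U. S a \<and> S b \<and> opair u a b \<and>
     \<not> (\<exists>w\<in>U. k u w \<and> (A u \<and> E w a \<or> \<not> A u \<and> E w b)))"

text \<open>Let \<open>d\<close> be the pair of \<open>a\<close> and \<open>b\<close>. Injectivity
  on the half containing \<open>d\<close> makes membership of its value in the relevant component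
  equivalent to \<open>diagonal k A d\<close>, whereas \<open>diagonal\<close> demands
  non-membership. That the images are sets is a hypothesis because \<open>k\<close> need not be
  definable in \<open>K\<close>.\<close>

lemma no_two_to_one_map:
  assumes tot: "\<And>u. S u \<Longrightarrow> \<exists>w\<in>U. k u w"
    and inj: "\<And>u u' w. S u \<Longrightarrow> S u' \<Longrightarrow> k u w \<Longrightarrow> k u' w \<Longrightarrow> A u = A u' \<Longrightarrow> u = u'"
    and fn: "\<And>u w w'. S u \<Longrightarrow> k u w \<Longrightarrow> k u w' \<Longrightarrow> w = w'"
    and a: "S a" "\<And>w. E w a \<longleftrightarrow> (\<exists>u. diagonal k A u \<and> A u \<and> k u w)"
    and b: "S b" "\<And>w. E w b \<longleftrightarrow> (\<exists>u. diagonal k A u \<and> \<not> A u \<and> k u w)"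
  shows False
proof -
  obtain d where d: "opair d a b" using opair_ex[OF a(1) b(1)] by blast
  have S: "S d" using opair_set[OF d] .
  obtain w where w: "w \<in> U" "k d w" using tot[OF S] by blast
  have "S u" if "diagonal k A u" for u using that unfolding diagonal_def by blast
  then have "A d \<and> E w a \<or> \<not> A d \<and> E w b \<longleftrightarrow> diagonal k A d"
    unfolding a(2) b(2) using inj[OF _ S _ w(2)] w(2) by blast
  moreover have "diagonal k A d \<longleftrightarrow> \<not> (A d \<and> E w a \<or> \<not> A d \<and> E w b)"
  proof
    assume "diagonal k A d"
    then obtain a' b' where ab: "S a'" "S b'" "opair d a' b'"
      "\<not> (\<exists>w\<in>U. k d w \<and> (A d \<and> E w a' \<or> \<not> A d \<and> E w b'))"
      unfolding diagonal_def by blast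
    then show "\<not> (A d \<and> E w a \<or> \<not> A d \<and> E w b)"
      using opair_inject[OF d ab(3) a(1) b(1) ab(1,2)] w by blast
  next
    assume "\<not> (A d \<and> E w a \<or> \<not> A d \<and> E w b)"
    then have "\<not> (\<exists>w\<in>U. k d w \<and> (A d \<and> E w a \<or> \<not> A d \<and> E w b))"
      using fn[OF S w(2)] by blast
    then show "diagonal k A d"
      unfolding diagonal_def using S d a(1) b(1) set_in_U[OF a(1)] set_in_U[OF b(1)] by blast
  qed
  ultimately show False by blast
qed

end

lemma (in km_model) collect:
  assumes "dpred1 K Q" "S c" "\<And>t. Q t \<Longrightarrow> E t c"
  shows "\<exists>d. S d \<and> (\<forall>t. E t d \<longleftrightarrow> Q t)"
  using separation[OF assms(1,2)] assms(3) by blast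

section \<open>Lifting definable predicates to the interpreting model\<close>

lemma dpred1_lift:
  assumes "interprets_par ar M N" "univ M \<noteq> {}" "dpred1 N P" "\<And>x. P x \<Longrightarrow> x \<in> univ N"
  shows "dpred1 M P"
proof -
  have "(\<lambda>x. x \<in> univ N \<and> P x) = P" using assms(4) by blast
  then show ?thesis using dpred1_interp[OF assms(1-3)] by simp
qed

lemma dpred2_lift:
  assumes "interprets_par ar M N" "univ M \<noteq> {}" "dpred2 N P"
    and "\<And>x y. P x y \<Longrightarrow> x \<in> univ N \<and> y \<in> univ N"
  shows "dpred2 M P"
proof -
  have "(\<lambda>x y. x \<in> univ N \<and> y \<in> univ N \<and> P x y) = P" using assms(4) by blast
  then show ?thesis using dpred2_interp[OF assms(1-3)] by simp
qed

lemma dpred_all_interp: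
  assumes I: "interprets_par ar M N" and ne: "univ M \<noteq> {}"
    and Q: "dpred M (\<lambda>w. Q (w 0) (\<lambda>i. w (Suc i)))"
  shows "dpred M (\<lambda>v. \<forall>x\<in>univ N. Q x v)"
proof -
  have "dpred M (\<lambda>w. w 0 \<in> univ N \<longrightarrow> Q (w 0) (\<lambda>i. w (Suc i)))"
    by (rule dpred_imp[OF dpred1_app[OF dpred_interp_univ[OF I ne] dterm_var] Q])
  then have "dpred M (\<lambda>v. \<forall>x\<in>univ M. x \<in> univ N \<longrightarrow> Q x v)" by (rule dpred_all)
  moreover have "(\<forall>x\<in>univ M. x \<in> univ N \<longrightarrow> Q x v) \<longleftrightarrow> (\<forall>x\<in>univ N. Q x v)" for v
    using interprets_univ[OF I] by blast
  ultimately show ?thesis by simp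
qed

lemma dpred_ex_interp:
  assumes I: "interprets_par ar M N" and ne: "univ M \<noteq> {}"
    and Q: "dpred M (\<lambda>w. Q (w 0) (\<lambda>i. w (Suc i)))"
  shows "dpred M (\<lambda>v. \<exists>x\<in>univ N. Q x v)"
proof -
  have "dpred M (\<lambda>v. \<not> (\<forall>x\<in>univ N. \<not> Q x v))"
    by (rule dpred_not[OF dpred_all_interp[OF I ne dpred_not[OF Q]]])
  then show ?thesis by simp
qed

section \<open>Comparing the sets of N with those of M*\<close>

locale km_triple = M: km_model M + N: km_model N + Ms: km_model Ms
  for M N Ms :: "('a, km_pred) struct" +
  fixes f :: "'a \<Rightarrow> 'a"
  assumes MN: "interprets_par km_arity M N" and NMs: "interprets_par km_arity N Ms"
    and f: "definable_iso M Ms f"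
begin

lemma N_univ: "x \<in> N.U \<Longrightarrow> x \<in> M.U" and Ms_univ: "x \<in> Ms.U \<Longrightarrow> x \<in> N.U"
  using interprets_univ[OF MN] interprets_univ[OF NMs] by auto

lemma Ms_set_univ: "Ms.S x \<Longrightarrow> x \<in> N.U"
  by (rule Ms_univ[OF Ms.set_in_U])

lemma Ms_mem_univ: "Ms.E x y \<Longrightarrow> x \<in> N.U \<and> y \<in> N.U"
  using Ms.mem_in_U[of x y] Ms_univ by blast

lemma N_Ms_set: "dpred1 N Ms.S"
  by (rule dpred1_lift[OF NMs N.ne Ms.dpred1_set Ms.set_in_U])

lemma N_Ms_mem: "dpred2 N Ms.E"
  by (rule dpred2_lift[OF NMs N.ne Ms.dpred2_mem Ms.mem_in_U])

lemma N_Ms_rank_le: "dpred2 N Ms.rank_le"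
  by (rule dpred2_lift[OF NMs N.ne Ms.dpred2_rank_le]) (auto dest: Ms.rank_le_set intro: Ms.set_in_U)

text \<open>\<open>G\<close> is the union of all coded partial isomorphisms between transitive collections of sets of
  N and of M*.\<close>

definition attempt :: "'a \<Rightarrow> 'a \<Rightarrow> 'a \<Rightarrow> bool" where
  "attempt p q r \<longleftrightarrow> (\<forall>x\<in>N.U. \<forall>y\<in>N.U. N.S x \<and> Ms.S y \<and> N.fcode p q r x y \<longrightarrow>
     (\<forall>w\<in>N.U. Ms.S w \<longrightarrow> (Ms.E w y \<longleftrightarrow> (\<exists>z\<in>N.U. N.E z x \<and> N.fcode p q r z w))) \<and>
     (\<forall>z\<in>N.U. N.E z x \<longrightarrow> (\<exists>w\<in>N.U. Ms.S w \<and> N.fcode p q r z w)))"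

definition G :: "'a \<Rightarrow> 'a \<Rightarrow> bool" where
  "G x y \<longleftrightarrow> N.S x \<and> Ms.S y \<and>
     (\<exists>p\<in>N.U. \<exists>q\<in>N.U. \<exists>r\<in>N.U. attempt p q r \<and> N.fcode p q r x y)"

lemmas N_rules = N.dpred_rules N.dpred_fcode dpred1_app[OF N_Ms_set] dpred2_app[OF N_Ms_mem]
  dpred2_app[OF N_Ms_rank_le] dpred2_app[OF N.dpred2_rank_le]
  dpred_all_interp[OF NMs N.ne] dpred_ex_interp[OF NMs N.ne]
  dpred1_app[OF dpred_interp_univ[OF NMs N.ne]]

lemma N_attempt: "dpred3 N attempt"
  unfolding N.dpred_unfold attempt_def by (intro N_rules)

lemma N_G: "dpred2 N G"
  unfolding N.dpred_unfold G_def by (intro N_rules dpred3_app[OF N_attempt])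

lemmas NG_rules = N_rules dpred2_app[OF N_G]

section \<open>\<open>G\<close> as an injective partial isomorphism\<close>

lemma G_set: "G x y \<Longrightarrow> N.S x \<and> Ms.S y"
  by (simp add: G_def)

lemma G_univ: "G x y \<Longrightarrow> x \<in> N.U \<and> y \<in> N.U"
  using G_set N.set_in_U Ms_set_univ by blast

text \<open>Induction on \<open>x\<close>: an element of \<open>y\<close> is the value of one
  attempt at some element of \<open>x\<close>. The other attempt is defined there too and agrees by
  hypothesis, so that value is also an element of \<open>y'\<close>.\<close>

lemma G_unique:
  assumes "G x y" "G x y'"
  shows "y = y'"
proof -
  define P where "P x \<longleftrightarrow> (\<forall>y\<in>N.U. \<forall>y'\<in>N.U. G x y \<longrightarrow> G x y' \<longrightarrow> y = y')" for x
  have "dpred1 N P"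
    unfolding N.dpred_unfold P_def by (intro NG_rules)
  then have "P x"
  proof (rule N.induct)
    show "N.S x" using G_set[OF assms(1)] by blast
    fix x assume x: "N.S x" and IH: "\<And>z. N.E z x \<Longrightarrow> P z"
    have sub: "Ms.E w y'" if y: "G x y" and y': "G x y'" and w: "Ms.E w y" for y y' w
    proof -
      obtain p q r where U: "p \<in> N.U" "q \<in> N.U" "r \<in> N.U" and a: "attempt p q r"
        and c: "N.fcode p q r x y"
        using y unfolding G_def by blast
      obtain p' q' r' where U': "p' \<in> N.U" "q' \<in> N.U" "r' \<in> N.U" and a': "attempt p' q' r'"
        and c': "N.fcode p' q' r' x y'"
        using y' unfolding G_def by blast
      have Sw: "Ms.S w" "w \<in> N.U" using Ms.mem_set[OF w] Ms_mem_univ[OF w] by auto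
      have Sy: "Ms.S y" "y \<in> N.U" "Ms.S y'" "y' \<in> N.U"
        using G_set[OF y] G_set[OF y'] G_univ[OF y] G_univ[OF y'] by auto
      have xU: "x \<in> N.U" using N.set_in_U[OF x] .
      obtain z where z: "z \<in> N.U" "N.E z x" "N.fcode p q r z w"
        using a[unfolded attempt_def, rule_format, OF xU Sy(2)] x Sy(1) c w Sw by blast
      obtain w' where w': "w' \<in> N.U" "Ms.S w'" "N.fcode p' q' r' z w'"
        using a'[unfolded attempt_def, rule_format, OF xU Sy(4)] x Sy(3) c' z by blast
      have "G z w" using N.mem_set[OF z(2)] Sw U a z(3) unfolding G_def by blast
      moreover have "G z w'" using N.mem_set[OF z(2)] w' U' a' unfolding G_def by blast
      ultimately have "w = w'" using IH[OF z(2)] Sw(2) w'(1) unfolding P_def by blast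
      then show "Ms.E w y'"
        using a'[unfolded attempt_def, rule_format, OF xU Sy(4)] x Sy(3) c' z(1,2) w' by blast
    qed
    have "y = y'" if y: "G x y" and y': "G x y'" for y y'
    proof (rule Ms.ext_sets)
      show "Ms.S y" "Ms.S y'" using G_set[OF y] G_set[OF y'] by auto
      show "Ms.E w y \<longleftrightarrow> Ms.E w y'" for w using sub[OF y y'] sub[OF y' y] by blast
    qed
    then show "P x" unfolding P_def by blast
  qed
  then show ?thesis using assms G_univ[OF assms(1)] G_univ[OF assms(2)] unfolding P_def by blast
qed

lemma G_elem:
  assumes G: "G x y" and z: "N.E z x"
  shows "\<exists>w. G z w"
proof -
  obtain p q r where U: "p \<in> N.U" "q \<in> N.U" "r \<in> N.U" and a: "attempt p q r"
    and c: "N.fcode p q r x y"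
    using G unfolding G_def by blast
  have U': "x \<in> N.U" "y \<in> N.U" using G_univ[OF G] by auto
  have zU: "z \<in> N.U" "N.S z" using N.mem_in_U[OF z] N.mem_set[OF z] by auto
  obtain w where "w \<in> N.U" "Ms.S w" "N.fcode p q r z w"
    using a[unfolded attempt_def, rule_format, OF U'] G_set[OF G] c z zU by blast
  then have "G z w" using zU U a unfolding G_def by blast
  then show ?thesis ..
qed

text \<open>From right to left, the pair of \<open>z\<close> and \<open>w\<close> may stem from an
  attempt other than the one for \<open>x\<close>; \<open>G_unique\<close> reconciles them.\<close>

lemma G_mem:
  assumes G: "G x y"
  shows "Ms.E w y \<longleftrightarrow> (\<exists>z. N.E z x \<and> G z w)"
proof -
  obtain p q r where U: "p \<in> N.U" "q \<in> N.U" "r \<in> N.U" and a: "attempt p q r"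
    and c: "N.fcode p q r x y"
    using G unfolding G_def by blast
  have U': "x \<in> N.U" "y \<in> N.U" using G_univ[OF G] by auto
  note a' = a[unfolded attempt_def, rule_format, OF U']
  show ?thesis
  proof
    assume w: "Ms.E w y"
    have Sw: "Ms.S w" "w \<in> N.U" using Ms.mem_set[OF w] Ms_mem_univ[OF w] by auto
    obtain z where z: "z \<in> N.U" "N.E z x" "N.fcode p q r z w"
      using a' G_set[OF G] c w Sw by blast
    have "G z w" using N.mem_set[OF z(2)] Sw U a z(3) unfolding G_def by blast
    with z show "\<exists>z. N.E z x \<and> G z w" by blast
  next
    assume "\<exists>z. N.E z x \<and> G z w"
    then obtain z where z: "N.E z x" "G z w" by blast
    have zU: "z \<in> N.U" "N.S z" using N.mem_in_U[OF z(1)] N.mem_set[OF z(1)] by auto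
    obtain w' where w': "w' \<in> N.U" "Ms.S w'" "N.fcode p q r z w'"
      using a' G_set[OF G] c z zU by blast
    then have "G z w'" using zU U a unfolding G_def by blast
    then have "w = w'" using G_unique z(2) by blast
    then show "Ms.E w y"
      using a' G_set[OF G] c z(1) zU w' by blast
  qed
qed

lemma G_extend:
  assumes x: "N.S x" and y: "Ms.S y" and dom: "\<And>z. N.E z x \<Longrightarrow> \<exists>w. G z w"
    and mem: "\<And>w. Ms.E w y \<longleftrightarrow> (\<exists>z. N.E z x \<and> G z w)"
  shows "G x y"
proof (cases "\<exists>y'. G x y'")
  case True
  then obtain y' where y': "G x y'" by blast
  have "y' = y"
    using G_mem[OF y'] mem G_set[OF y'] by (intro Ms.ext_sets y) auto
  then show ?thesis using y' by simp
next
  case False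
  have U: "x \<in> N.U" "y \<in> N.U" using N.set_in_U[OF x] Ms_set_univ[OF y] .
  define H where "H x' y' \<longleftrightarrow> G x' y' \<or> x' = x \<and> y' = y" for x' y'
  have "dpred2 N H"
    unfolding N.dpred_unfold H_def using U by (intro NG_rules)
  moreover have "y' = y''" if "H x' y'" "H x' y''" for x' y' y''
    using that False G_unique unfolding H_def by blast
  ultimately obtain p q r where U': "p \<in> N.U" "q \<in> N.U" "r \<in> N.U"
    and c: "\<forall>x' y'. N.S x' \<longrightarrow> y' \<in> N.U \<longrightarrow> (N.fcode p q r x' y' \<longleftrightarrow> H x' y')"
    using N.fcoding[of H] by blast
  have "attempt p q r"
    unfolding attempt_def
  proof (intro ballI impI, elim conjE)
    fix x' y' assume "x' \<in> N.U" and y'U: "y' \<in> N.U" and x': "N.S x'" and y': "Ms.S y'"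
      and "N.fcode p q r x' y'"
    then have H: "H x' y'" using c by blast
    \<comment> \<open>The added pair is invisible at elements of \<open>x'\<close>: \<open>x\<close>
      is neither an element of itself nor of anything in the domain of \<open>G\<close>, which is
      transitive and omits \<open>x\<close>.\<close>
    have *: "H z w \<longleftrightarrow> G z w" if z: "N.E z x'" for z w
    proof -
      have "z \<noteq> x"
      proof
        assume "z = x"
        then show False
          using H z False G_elem[of x' y' x] N.not_mem_self[of x] unfolding H_def by blast
      qed
      then show ?thesis unfolding H_def by blast
    qed
    have **: "N.fcode p q r z w \<longleftrightarrow> G z w" if "N.E z x'" "w \<in> N.U" for z w
      using c N.mem_set[OF that(1)] that *[OF that(1)] by blast
    have dom': "\<exists>w. G z w" if "N.E z x'" for z
      using H that dom G_elem unfolding H_def by blast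
    have mem': "Ms.E w y' \<longleftrightarrow> (\<exists>z. N.E z x' \<and> G z w)" for w
      using H mem G_mem unfolding H_def by blast
    show "(\<forall>w\<in>N.U. Ms.S w \<longrightarrow> (Ms.E w y' \<longleftrightarrow> (\<exists>z\<in>N.U. N.E z x' \<and> N.fcode p q r z w))) \<and>
      (\<forall>z\<in>N.U. N.E z x' \<longrightarrow> (\<exists>w\<in>N.U. Ms.S w \<and> N.fcode p q r z w))"
    proof (intro conjI ballI impI)
      fix w assume w: "w \<in> N.U"
      have "(\<exists>z. N.E z x' \<and> G z w) \<longleftrightarrow> (\<exists>z\<in>N.U. N.E z x' \<and> N.fcode p q r z w)"
        using **[OF _ w] G_univ by blast
      then show "Ms.E w y' \<longleftrightarrow> (\<exists>z\<in>N.U. N.E z x' \<and> N.fcode p q r z w)" using mem' by simp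
    next
      fix z assume z: "N.E z x'"
      obtain w where w: "G z w" using dom'[OF z] by blast
      then show "\<exists>w\<in>N.U. Ms.S w \<and> N.fcode p q r z w"
        using **[OF z] G_univ[OF w] G_set[OF w] by blast
    qed
  qed
  moreover have "N.fcode p q r x y" using c x U(2) unfolding H_def by blast
  ultimately show ?thesis using x y U' unfolding G_def by blast
qed

lemma G_inject:
  assumes "G x y" "G x' y"
  shows "x = x'"
proof -
  define P where "P x \<longleftrightarrow> (\<forall>x'\<in>N.U. \<forall>y\<in>N.U. G x y \<longrightarrow> G x' y \<longrightarrow> x = x')" for x
  have "dpred1 N P"
    unfolding N.dpred_unfold P_def by (intro NG_rules)
  then have "P x"
  proof (rule N.induct)
    show "N.S x" using G_set[OF assms(1)] by blast
    fix x assume x: "N.S x" and IH: "\<And>z. N.E z x \<Longrightarrow> P z"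
    have IH': "z = z'" if "N.E z x" "G z w" "G z' w" for z z' w
      using IH[OF that(1)] that(2,3) G_univ[OF that(2)] G_univ[OF that(3)] unfolding P_def by blast
    have "x = x'" if y: "G x y" and y': "G x' y" for x' y
    proof (rule N.ext_sets)
      show "N.S x" "N.S x'" using G_set[OF y] G_set[OF y'] by auto
      fix z
      show "N.E z x \<longleftrightarrow> N.E z x'"
      proof
        assume z: "N.E z x"
        obtain w where w: "G z w" using G_elem[OF y z] by blast
        then have "Ms.E w y" using G_mem[OF y] z by blast
        then obtain z' where "N.E z' x'" "G z' w" using G_mem[OF y'] by blast
        then show "N.E z x'" using IH'[OF z w] by blast
      next
        assume z: "N.E z x'"
        obtain w where w: "G z w" using G_elem[OF y' z] by blast
        then have "Ms.E w y" using G_mem[OF y'] z by blast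
        then obtain z' where "N.E z' x" "G z' w" using G_mem[OF y] by blast
        then show "N.E z x" using IH' w by blast
      qed
    qed
    then show "P x" unfolding P_def by blast
  qed
  then show ?thesis using assms G_univ[OF assms(1)] G_univ[OF assms(2)] unfolding P_def by blast
qed


section \<open>Transfer along the isomorphism of M and M*\<close>

lemma f_iso: "isomorphism M Ms f" and f_graph: "definable M 2 {[a, f a] | a. a \<in> M.U}"
  using f unfolding definable_iso_def by auto

lemma f_bij: "bij_betw f M.U Ms.U"
  using f_iso by (simp add: isomorphism_def)

lemma f_univ: "x \<in> M.U \<Longrightarrow> f x \<in> Ms.U"
  using f_bij by (rule bij_betwE[rule_format])

lemma f_inject: "x \<in> M.U \<Longrightarrow> y \<in> M.U \<Longrightarrow> f x = f y \<Longrightarrow> x = y"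
  using f_bij by (auto simp: bij_betw_def inj_on_def)

lemma f_surj: "y \<in> Ms.U \<Longrightarrow> \<exists>x\<in>M.U. y = f x"
  using f_bij by (auto simp: bij_betw_def)

lemma f_inv: "x \<in> M.U \<Longrightarrow> inv_into M.U f (f x) = x"
  using f_bij by (simp add: bij_betw_def)

lemma f_set: "x \<in> M.U \<Longrightarrow> Ms.S (f x) \<longleftrightarrow> M.S x"
proof -
  assume "x \<in> M.U"
  then have "set [x] \<subseteq> M.U" by simp
  then have "[x] \<in> rel M SetP \<longleftrightarrow> map f [x] \<in> rel Ms SetP"
    using f_iso unfolding isomorphism_def by blast
  then show ?thesis by (simp add: is_set_def)
qed

lemma f_mem: "x \<in> M.U \<Longrightarrow> y \<in> M.U \<Longrightarrow> Ms.E (f x) (f y) \<longleftrightarrow> M.E x y"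
proof -
  assume "x \<in> M.U" "y \<in> M.U"
  then have "set [x, y] \<subseteq> M.U" by simp
  then have "[x, y] \<in> rel M MemP \<longleftrightarrow> map f [x, y] \<in> rel Ms MemP"
    using f_iso unfolding isomorphism_def by blast
  then show ?thesis by (simp add: mem_def)
qed

lemma M_graph: "dpred2 M (\<lambda>x y. x \<in> M.U \<and> y = f x)"
proof -
  have "dpred M (\<lambda>v. map (\<lambda>i. v i) [0, Suc 0] \<in> {[a, f a] | a. a \<in> M.U})"
    by (rule dpred_definable[OF f_graph M.ne dterm_var])
  moreover have "(\<lambda>v. map (\<lambda>i. v i) [0, Suc 0] \<in> {[a, f a] | a. a \<in> M.U}) =
    (\<lambda>v. v 0 \<in> M.U \<and> v (Suc 0) = f (v 0))"
    by (auto simp: fun_eq_iff)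
  ultimately show ?thesis unfolding dpred2_def by simp
qed

lemma M_univ: "dpred1 M (\<lambda>x. x \<in> M.U)"
proof -
  have "dpred M (\<lambda>v. \<exists>x\<in>M.U. x = v 0)" by (intro M.dpred_rules)
  then show ?thesis by (simp add: dpred1_def)
qed

lemma dpred_apply:
  assumes "dpred1 M P"
  shows "dpred1 M (\<lambda>x. x \<in> M.U \<and> P (f x))"
proof -
  have "dpred M (\<lambda>v. \<exists>y\<in>M.U. (v 0 \<in> M.U \<and> y = f (v 0)) \<and> P y)"
    by (intro M.dpred_rules dpred2_app[OF M_graph] dpred1_app[OF assms])
  moreover have "(\<exists>y\<in>M.U. (x \<in> M.U \<and> y = f x) \<and> P y) \<longleftrightarrow> x \<in> M.U \<and> P (f x)" for x
    using N_univ Ms_univ f_univ by blast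
  ultimately show ?thesis by (simp add: dpred1_def)
qed

lemma dpred_image:
  assumes "dpred1 M P"
  shows "dpred1 Ms (\<lambda>y. \<exists>x\<in>M.U. y = f x \<and> P x)"
proof -
  have "dpred Ms (\<lambda>v. P (inv_into M.U f (v 0)))"
    using dpred_iso[OF f_iso assms[unfolded dpred1_def]] .
  then show ?thesis unfolding dpred1_def
  proof (rule dpred_cong)
    fix v assume "asg Ms v"
    then have "v 0 \<in> Ms.U" by (simp add: asg_def)
    then obtain x where "x \<in> M.U" "v 0 = f x" using f_surj by blast
    then show "(\<exists>x\<in>M.U. v 0 = f x \<and> P x) \<longleftrightarrow> P (inv_into M.U f (v 0))"
      using f_inv[of x] f_inject by auto
  qed
qed

text \<open>Composition with \<open>f\<close> stays definable in M, and the image of the composite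
  under \<open>f\<close> is \<open>P\<close> again, now on the universe of M*.\<close>

lemma dpred_M_Ms:
  assumes "dpred1 M P"
  shows "dpred1 Ms P"
proof -
  have "dpred1 Ms (\<lambda>y. \<exists>x\<in>M.U. y = f x \<and> (x \<in> M.U \<and> P (f x)))"
    by (rule dpred_image[OF dpred_apply[OF assms]])
  then show ?thesis unfolding dpred1_def
  proof (rule dpred_cong)
    fix v assume "asg Ms v"
    then have "v 0 \<in> Ms.U" by (simp add: asg_def)
    then show "P (v 0) \<longleftrightarrow> (\<exists>x\<in>M.U. v 0 = f x \<and> x \<in> M.U \<and> P (f x))"
      using f_surj[of "v 0"] by auto
  qed
qed

text \<open>Definability passes from N up to M and from there to M*, where separation
  applies.\<close>

lemma Ms_collect:
  assumes "dpred1 N Q" "Ms.S c" "\<And>t. Q t \<Longrightarrow> Ms.E t c"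
  shows "\<exists>d. Ms.S d \<and> (\<forall>t. Ms.E t d \<longleftrightarrow> Q t)"
proof (rule Ms.collect[OF dpred_M_Ms assms(2,3)])
  show "dpred1 M Q"
    using assms(3) Ms_mem_univ by (intro dpred1_lift[OF MN M.ne assms(1)]) blast
qed

section \<open>Closure of \<open>G\<close> under smaller rank\<close>

lemma G_rank_le:
  assumes "G v w" "N.rank_le u v"
  shows "\<exists>t. G u t \<and> Ms.rank_le t w"
proof -
  define P where "P v \<longleftrightarrow> (\<forall>w\<in>N.U. \<forall>u\<in>N.U. G v w \<longrightarrow> N.rank_le u v \<longrightarrow>
    (\<exists>t\<in>N.U. G u t \<and> Ms.rank_le t w))" for v
  have "dpred1 N P"
    unfolding N.dpred_unfold P_def by (intro NG_rules)
  then have "P v"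
  proof (rule N.induct)
    show "N.S v" using G_set[OF assms(1)] by blast
    fix v assume "N.S v" and IH: "\<And>v'. N.E v' v \<Longrightarrow> P v'"
    have "\<exists>t. G u t \<and> Ms.rank_le t w" if G: "G v w" and u: "N.rank_le u v" for u w
    proof -
      have Su: "N.S u" "u \<in> N.U" using N.rank_le_set[OF u] N.set_in_U by auto
      have Sw: "Ms.S w" using G_set[OF G] by blast
      have elem: "\<exists>t' w'. G u' t' \<and> Ms.E w' w \<and> Ms.rank_le t' w'" if u': "N.E u' u" for u'
      proof -
        obtain v' where v': "N.E v' v" "N.rank_le u' v'" using N.rank_leD[OF u u'] by blast
        obtain w' where w': "G v' w'" using G_elem[OF G v'(1)] by blast
        have "Ms.E w' w" using G_mem[OF G] v'(1) w' by blast
        moreover obtain t' where "G u' t'" "Ms.rank_le t' w'"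
          using IH[OF v'(1)] v'(2) w' G_univ[OF w'] N.mem_in_U[OF u'] unfolding P_def by blast
        ultimately show ?thesis by blast
      qed
      \<comment> \<open>All images of elements of \<open>u\<close> lie in this one set of M*, so
        they can be collected into the value of \<open>G\<close> at \<open>u\<close>.\<close>
      obtain c where c: "Ms.S c" "\<forall>w' t'. Ms.E w' w \<longrightarrow> Ms.rank_le t' w' \<longrightarrow> Ms.E t' c"
        using Ms.rank_le_bound_below[OF Sw] by blast
      define Q where "Q t' \<longleftrightarrow> (\<exists>u'\<in>N.U. N.E u' u \<and> G u' t')" for t'
      have "dpred1 N Q"
        unfolding N.dpred_unfold Q_def using Su by (intro NG_rules)
      moreover have "Ms.E t' c" if "Q t'" for t'
        using that elem c(2) G_unique unfolding Q_def by blast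
      ultimately obtain t where t: "Ms.S t" "\<forall>t'. Ms.E t' t \<longleftrightarrow> Q t'"
        using Ms_collect[OF _ c(1)] by blast
      have "G u t"
      proof (rule G_extend[OF Su(1) t(1)])
        show "\<exists>w. G z w" if "N.E z u" for z using elem[OF that] by blast
        show "Ms.E w t \<longleftrightarrow> (\<exists>z. N.E z u \<and> G z w)" for w
          using t(2) G_univ unfolding Q_def by blast
      qed
      moreover have "Ms.rank_le t w"
      proof (rule Ms.rank_leI[OF t(1) Sw])
        fix t' assume "Ms.E t' t"
        then obtain u' where "N.E u' u" "G u' t'" using t(2) unfolding Q_def by blast
        then show "\<exists>w'. Ms.E w' w \<and> Ms.rank_le t' w'" using elem G_unique by blast
      qed
      ultimately show ?thesis by blast
    qed
    then show "P v" unfolding P_def using G_univ by blast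
  qed
  then show ?thesis
    using assms G_univ[OF assms(1)] N.rank_le_set[OF assms(2)] N.set_in_U unfolding P_def by blast
qed

text \<open>The mirror image of \<open>G_rank_le\<close>, with the induction still on the side of N,
  where the statement is definable.\<close>

lemma G_rank_le':
  assumes "G v w" "Ms.rank_le t w"
  shows "\<exists>u. G u t \<and> N.rank_le u v"
proof -
  define P where "P v \<longleftrightarrow> (\<forall>w\<in>N.U. \<forall>t\<in>N.U. G v w \<longrightarrow> Ms.rank_le t w \<longrightarrow>
    (\<exists>u\<in>N.U. G u t \<and> N.rank_le u v))" for v
  have "dpred1 N P"
    unfolding N.dpred_unfold P_def by (intro NG_rules)
  then have "P v"
  proof (rule N.induct)
    show "N.S v" using G_set[OF assms(1)] by blast
    fix v assume Sv: "N.S v" and IH: "\<And>v'. N.E v' v \<Longrightarrow> P v'"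
    have "\<exists>u. G u t \<and> N.rank_le u v" if G: "G v w" and t: "Ms.rank_le t w" for t w
    proof -
      have St: "Ms.S t" "t \<in> N.U" using Ms.rank_le_set[OF t] Ms_set_univ by auto
      have elem: "\<exists>u' v'. G u' t' \<and> N.E v' v \<and> N.rank_le u' v'" if t': "Ms.E t' t" for t'
      proof -
        obtain w' where w': "Ms.E w' w" "Ms.rank_le t' w'" using Ms.rank_leD[OF t t'] by blast
        obtain v' where v': "N.E v' v" "G v' w'" using G_mem[OF G] w'(1) by blast
        obtain u' where "G u' t'" "N.rank_le u' v'"
          using IH[OF v'(1)] v'(2) w' G_univ[OF v'(2)] Ms_mem_univ[OF t'] unfolding P_def by blast
        with v' show ?thesis by blast
      qed
      obtain c where c: "N.S c" "\<forall>v' u'. N.E v' v \<longrightarrow> N.rank_le u' v' \<longrightarrow> N.E u' c"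
        using N.rank_le_bound_below[OF Sv] by blast
      define Q where "Q u' \<longleftrightarrow> (\<exists>t'\<in>N.U. Ms.E t' t \<and> G u' t')" for u'
      have "dpred1 N Q"
        unfolding N.dpred_unfold Q_def using St by (intro NG_rules)
      moreover have "N.E u' c" if "Q u'" for u'
        using that elem c(2) G_inject unfolding Q_def by blast
      ultimately obtain u where u: "N.S u" "\<forall>u'. N.E u' u \<longleftrightarrow> Q u'"
        using N.collect[OF _ c(1)] by blast
      have "G u t"
      proof (rule G_extend[OF u(1) St(1)])
        show "\<exists>w. G z w" if "N.E z u" for z using that u(2) unfolding Q_def by blast
        show "Ms.E w t \<longleftrightarrow> (\<exists>z. N.E z u \<and> G z w)" for w
          using u(2) elem[of w] G_unique G_univ unfolding Q_def by blast
      qed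
      moreover have "N.rank_le u v"
      proof (rule N.rank_leI[OF u(1) Sv])
        fix u' assume "N.E u' u"
        then obtain t' where "Ms.E t' t" "G u' t'" using u(2) unfolding Q_def by blast
        then show "\<exists>v'. N.E v' v \<and> N.rank_le u' v'" using elem G_inject by blast
      qed
      ultimately show ?thesis by blast
    qed
    then show "P v" unfolding P_def using G_univ by blast
  qed
  then show ?thesis
    using assms G_univ[OF assms(1)] Ms.rank_le_set[OF assms(2)] Ms_set_univ unfolding P_def by blast
qed

text \<open>If \<open>y\<close> were below some \<open>z\<close> in the domain, it would be in the
  domain itself. By linearity every such \<open>z\<close> is below \<open>y\<close>, and the sets
  below \<open>y\<close> are bounded.\<close>

lemma dom_bounded:
  assumes y: "N.S y" "\<nexists>w. G y w"
  shows "\<exists>a. N.S a \<and> (\<forall>z. N.E z a \<longleftrightarrow> (\<exists>w. G z w))"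
proof -
  obtain b where b: "N.S b" "\<forall>u. N.rank_le u y \<longrightarrow> N.E u b" using N.rank_le_bound[OF y(1)] by blast
  have "dpred1 N (\<lambda>z. \<exists>w\<in>N.U. G z w)"
    unfolding N.dpred_unfold by (intro NG_rules)
  moreover have "(\<lambda>z. \<exists>w\<in>N.U. G z w) = (\<lambda>z. \<exists>w. G z w)" using G_univ by blast
  ultimately have "dpred1 N (\<lambda>z. \<exists>w. G z w)" by simp
  then show ?thesis
  proof (rule N.collect[OF _ b(1)])
    fix z assume "\<exists>w. G z w"
    then obtain w where w: "G z w" by blast
    have "\<not> N.rank_le y z" using G_rank_le[OF w] y(2) by blast
    then have "N.rank_le z y" using N.rank_le_linear[OF y(1)] G_set[OF w] by blast
    then show "N.E z b" using b(2) by blast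
  qed
qed

lemma ran_bounded:
  assumes y: "Ms.S y" "\<nexists>z. G z y"
  shows "\<exists>b. Ms.S b \<and> (\<forall>w. Ms.E w b \<longleftrightarrow> (\<exists>z. G z w))"
proof -
  obtain b where b: "Ms.S b" "\<forall>u. Ms.rank_le u y \<longrightarrow> Ms.E u b" using Ms.rank_le_bound[OF y(1)] by blast
  have "dpred1 N (\<lambda>w. \<exists>z\<in>N.U. G z w)"
    unfolding N.dpred_unfold by (intro NG_rules)
  moreover have "(\<lambda>w. \<exists>z\<in>N.U. G z w) = (\<lambda>w. \<exists>z. G z w)" using G_univ by blast
  ultimately have "dpred1 N (\<lambda>w. \<exists>z. G z w)" by simp
  then show ?thesis
  proof (rule Ms_collect[OF _ b(1)])
    fix w assume "\<exists>z. G z w"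
    then obtain z where z: "G z w" by blast
    have "\<not> Ms.rank_le y w" using G_rank_le'[OF z] y(2) by blast
    then have "Ms.rank_le w y" using Ms.rank_le_linear[OF y(1)] G_set[OF z] by blast
    then show "Ms.E w b" using b(2) by blast
  qed
qed

lemma total_or_onto: "(\<forall>y. N.S y \<longrightarrow> (\<exists>w. G y w)) \<or> (\<forall>w. Ms.S w \<longrightarrow> (\<exists>z. G z w))"
proof (rule ccontr)
  assume "\<not> ?thesis"
  then obtain y w where y: "N.S y" "\<nexists>w. G y w" and w: "Ms.S w" "\<nexists>z. G z w" by blast
  obtain a where a: "N.S a" "\<forall>z. N.E z a \<longleftrightarrow> (\<exists>w. G z w)"
    using dom_bounded[OF y] by (elim exE conjE)
  obtain b where b: "Ms.S b" "\<forall>w. Ms.E w b \<longleftrightarrow> (\<exists>z. G z w)"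
    using ran_bounded[OF w] by (elim exE conjE)
  have "\<exists>w. G z w" if "N.E z a" for z using a(2) that by simp
  moreover have "Ms.E w b \<longleftrightarrow> (\<exists>z. N.E z a \<and> G z w)" for w
    using a(2) b(2) by auto
  \<comment> \<open>Domain and range form one more pair of \<open>G\<close>, which puts
    \<open>a\<close> into the domain, that is, into \<open>a\<close>.\<close>
  ultimately have ab: "G a b" by (rule G_extend[OF a(1) b(1)])
  then have "N.E a a" using a(2) by blast
  then show False using N.not_mem_self by simp
qed


section \<open>The two applications of Cantor's theorem\<close>

lemma M_N_set: "dpred1 M N.S"
  by (rule dpred1_lift[OF MN M.ne N.dpred1_set N.set_in_U])

lemma M_N_mem: "dpred2 M N.E"
  by (rule dpred2_lift[OF MN M.ne N.dpred2_mem N.mem_in_U])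

lemma M_Ms_mem: "dpred2 M Ms.E"
  by (rule dpred2_lift[OF MN M.ne N_Ms_mem Ms_mem_univ])

lemma M_G: "dpred2 M G"
  by (rule dpred2_lift[OF MN M.ne N_G G_univ])

lemmas M_rules = M.dpred_rules dpred1_app[OF M_N_set] dpred2_app[OF M_N_mem]
  dpred2_app[OF M_Ms_mem] dpred2_app[OF M_G] dpred2_app[OF M_graph] dpred1_app[OF M_univ]
  dpred_all_interp[OF MN M.ne] dpred_ex_interp[OF MN M.ne]

text \<open>Both \<open>x\<close> and \<open>y\<close> may be sets or classes: only extensions are
  compared, so that the relation serves Cantor's theorem as well as the final isomorphism.\<close>

definition preimage :: "'a \<Rightarrow> 'a \<Rightarrow> bool" where
  "preimage x y \<longleftrightarrow> (\<forall>z\<in>N.U. N.E z y \<longleftrightarrow> (\<exists>t\<in>N.U. G z t \<and> Ms.E t x))"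

lemma N_preimage: "dpred2 N preimage"
  unfolding N.dpred_unfold preimage_def by (intro NG_rules)

lemma preimage_iff: "preimage x y \<longleftrightarrow> (\<forall>z. N.E z y \<longleftrightarrow> (\<exists>t. G z t \<and> Ms.E t x))"
proof -
  have "N.E z y \<longrightarrow> z \<in> N.U" for z using N.mem_in_U[of z y] by blast
  moreover have "G z t \<longrightarrow> z \<in> N.U \<and> t \<in> N.U" for z t using G_univ[of z t] by blast
  ultimately show ?thesis unfolding preimage_def by meson
qed

lemma preimage_unique:
  assumes "preimage x y" "preimage x y'" "y \<in> N.U" "y' \<in> N.U" "N.S y \<longleftrightarrow> N.S y'"
  shows "y = y'"
proof (rule N.ext[OF assms(3-5)])
  fix z show "N.E z y \<longleftrightarrow> N.E z y'"
    using assms(1,2)[unfolded preimage_iff, rule_format, of z] by blast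
qed

lemma preimage_inject:
  assumes onto: "\<forall>w. Ms.S w \<longrightarrow> (\<exists>z. G z w)"
    and "preimage x y" "preimage x' y" "x \<in> Ms.U" "x' \<in> Ms.U" "Ms.S x \<longleftrightarrow> Ms.S x'"
  shows "x = x'"
proof (rule Ms.ext[OF assms(4-6)])
  have "Ms.E t x'" if t: "Ms.E t x" and p: "preimage x y" "preimage x' y" for t x x'
  proof -
    obtain z where z: "G z t" using onto Ms.mem_set[OF t] by blast
    then have "N.E z y" using p(1) t unfolding preimage_iff by blast
    then obtain t' where "G z t'" "Ms.E t' x'" using p(2) unfolding preimage_iff by blast
    then show ?thesis using G_unique z by blast
  qed
  then show "Ms.E t x \<longleftrightarrow> Ms.E t x'" for t using assms(2,3) by blast
qed

lemma M_preimage: "dpred2 M (\<lambda>x y. x \<in> M.U \<and> preimage (f x) y)"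
proof -
  have "dpred M (\<lambda>v. \<exists>s\<in>M.U. (v 0 \<in> M.U \<and> s = f (v 0)) \<and>
    (\<forall>z\<in>N.U. N.E z (v (Suc 0)) \<longleftrightarrow> (\<exists>t\<in>N.U. G z t \<and> Ms.E t s)))"
    by (intro M_rules)
  moreover have "(\<exists>s\<in>M.U. (x \<in> M.U \<and> s = f x) \<and>
    (\<forall>z\<in>N.U. N.E z y \<longleftrightarrow> (\<exists>t\<in>N.U. G z t \<and> Ms.E t s))) \<longleftrightarrow> x \<in> M.U \<and> preimage (f x) y" for x y
    unfolding preimage_def using f_univ Ms_univ N_univ by blast
  ultimately show ?thesis unfolding M.dpred_unfold by simp
qed

text \<open>The way from M back to N: the image under \<open>f\<close> is definable in M*, which N
  interprets.\<close>

lemma N_dpred_image: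
  assumes "dpred1 M P"
  shows "dpred1 N (\<lambda>y. \<exists>x\<in>M.U. y = f x \<and> P x)"
  by (rule dpred1_lift[OF NMs N.ne dpred_image[OF assms]]) (auto intro: f_univ)

text \<open>If \<open>G\<close> were not total, M* would be a set of N together with all its subsets definable in M,
  and N would inject into it.\<close>

lemma onto_imp_total:
  assumes onto: "\<forall>w. Ms.S w \<longrightarrow> (\<exists>z. G z w)"
  shows "\<forall>y. N.S y \<longrightarrow> (\<exists>w. G y w)"
proof (rule ccontr)
  assume "\<not> ?thesis"
  then obtain a where a: "N.S a" "\<forall>z. N.E z a \<longleftrightarrow> (\<exists>w. G z w)" using dom_bounded by blast
  obtain pa where pa: "N.S pa" "\<forall>w. N.E w pa \<longleftrightarrow> N.S w \<and> (\<forall>y. N.E y w \<longrightarrow> N.E y a)"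
    using N.powerset[OF a(1)] by blast
  have sub: "N.E w pa" if "N.S w" "preimage x w" for x w
    using that pa(2) a(2) unfolding preimage_iff by blast
  \<comment> \<open>As an object of M, \<open>u\<close> is sent into M* by \<open>f\<close>, and
    \<open>G\<close> pulls the extension of \<open>f u\<close> back to a subset of
    \<open>a\<close>.\<close>
  define k where "k u w \<longleftrightarrow> N.S w \<and> u \<in> M.U \<and> preimage (f u) w" for u w
  \<comment> \<open>\<open>preimage\<close> forgets whether \<open>f u\<close> is a set or a class
    of M*; as \<open>f\<close> preserves the sorts, splitting by \<open>M.S\<close> restores
    injectivity.\<close>
  define D where "D = N.diagonal k M.S"
  have k: "dpred2 M k"
    unfolding M.dpred_unfold k_def by (intro M_rules dpred2_app[OF M_preimage])
  have D: "dpred1 M D"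
    unfolding M.dpred_unfold D_def N.diagonal_def N.opair_def N.upair_def
    by (intro M_rules dpred2_app[OF k])
  \<comment> \<open>Although \<open>k\<close> involves \<open>f\<close>, the objects
    \<open>f u\<close> in question form a collection definable in N, and the passage from
    \<open>f u\<close> to \<open>w\<close> is definable in N as well.\<close>
  have img: "\<exists>c. N.S c \<and> (\<forall>w. N.E w c \<longleftrightarrow> (\<exists>u. D u \<and> B u \<and> k u w))"
    if B: "dpred1 M B" for B
  proof (rule N.collect[OF _ pa(1)])
    have "dpred1 M (\<lambda>u. D u \<and> B u)"
      unfolding M.dpred_unfold by (intro M_rules dpred1_app[OF D] dpred1_app[OF B])
    from N_dpred_image[OF this]
    have "dpred N (\<lambda>v. \<exists>x\<in>N.U. (\<exists>u\<in>M.U. x = f u \<and> (D u \<and> B u)) \<and> N.S (v 0) \<and> preimage x (v 0))"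
      by (intro NG_rules dpred2_app[OF N_preimage] dpred1_app)
    moreover have "(\<exists>x\<in>N.U. (\<exists>u\<in>M.U. x = f u \<and> (D u \<and> B u)) \<and> N.S w \<and> preimage x w) \<longleftrightarrow>
        (\<exists>u. D u \<and> B u \<and> k u w)" for w
      unfolding k_def using f_univ Ms_univ by blast
    ultimately show "dpred1 N (\<lambda>w. \<exists>u. D u \<and> B u \<and> k u w)" unfolding N.dpred_unfold by simp
    show "N.E w pa" if "\<exists>u. D u \<and> B u \<and> k u w" for w
      using that sub unfolding k_def by blast
  qed
  have notS: "dpred1 M (\<lambda>u. \<not> M.S u)" unfolding M.dpred_unfold by (intro M_rules)
  obtain c where c: "N.S c" "\<forall>w. N.E w c \<longleftrightarrow> (\<exists>u. D u \<and> M.S u \<and> k u w)"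
    using img[OF M.dpred1_set] by blast
  obtain d where d: "N.S d" "\<forall>w. N.E w d \<longleftrightarrow> (\<exists>u. D u \<and> \<not> M.S u \<and> k u w)"
    using img[OF notS] by blast
  show False
  proof (rule N.no_two_to_one_map[where k = k and A = M.S and a = c and b = d])
    fix u assume u: "N.S u"
    then have uU: "u \<in> M.U" using N_univ N.set_in_U by blast
    then have fu: "f u \<in> N.U" using f_univ Ms_univ by blast
    define Q where "Q z \<longleftrightarrow> (\<exists>t\<in>N.U. G z t \<and> Ms.E t (f u))" for z
    have "dpred1 N Q"
      unfolding N.dpred_unfold Q_def using fu by (intro NG_rules)
    moreover have "N.E z a" if "Q z" for z using that a(2) unfolding Q_def by blast
    ultimately obtain w where w: "N.S w" "\<forall>z. N.E z w \<longleftrightarrow> Q z"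
      using N.collect[OF _ a(1)] by blast
    then have "preimage (f u) w" unfolding preimage_def Q_def by blast
    then show "\<exists>w\<in>N.U. k u w" unfolding k_def using w(1) uU N.set_in_U by blast
  next
    fix u u' w assume "k u w" "k u' w" and A: "M.S u = M.S u'"
    then have p: "preimage (f u) w" "preimage (f u') w" "u \<in> M.U" "u' \<in> M.U"
      unfolding k_def by auto
    have "f u = f u'"
      using preimage_inject[OF onto p(1,2) f_univ[OF p(3)] f_univ[OF p(4)]] A f_set p(3,4) by blast
    then show "u = u'" by (rule f_inject[OF p(3,4)])
  next
    fix u w w' assume "k u w" "k u w'"
    then show "w = w'" unfolding k_def using preimage_unique N.set_in_U by blast
  qed (use c d in \<open>simp_all add: D_def\<close>)
qed

text \<open>If \<open>G\<close> were not onto, N would be a set of M* together with all its subsets, and M* would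
  inject into it.\<close>

lemma total_imp_onto:
  assumes total: "\<forall>y. N.S y \<longrightarrow> (\<exists>w. G y w)"
  shows "\<forall>w. Ms.S w \<longrightarrow> (\<exists>z. G z w)"
proof (rule ccontr)
  assume "\<not> ?thesis"
  then obtain b where b: "Ms.S b" "\<forall>w. Ms.E w b \<longleftrightarrow> (\<exists>z. G z w)" using ran_bounded by blast
  obtain pb where pb: "Ms.S pb" "\<forall>w. Ms.E w pb \<longleftrightarrow> Ms.S w \<and> (\<forall>y. Ms.E y w \<longrightarrow> Ms.E y b)"
    using Ms.powerset[OF b(1)] by blast
  \<comment> \<open>A set of M* is an object of N; \<open>G\<close> carries its elements in the
    sense of N to a subset of \<open>b\<close>.\<close>
  define k where "k u w \<longleftrightarrow> u \<in> N.U \<and> Ms.S w \<and>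
    (\<forall>t\<in>N.U. Ms.E t w \<longleftrightarrow> (\<exists>z\<in>N.U. N.E z u \<and> G z t))" for u w
  have k_iff: "k u w \<longleftrightarrow> u \<in> N.U \<and> Ms.S w \<and> (\<forall>t. Ms.E t w \<longleftrightarrow> (\<exists>z. N.E z u \<and> G z t))" for u w
    unfolding k_def using G_univ Ms_mem_univ by blast
  \<comment> \<open>Now \<open>u\<close> enters through its extension in N, so the split is by its
    sort in N.\<close>
  define D where "D = Ms.diagonal k N.S"
  have N_U: "dpred1 N (\<lambda>x. x \<in> N.U)"
  proof -
    have "dpred N (\<lambda>v. \<exists>x\<in>N.U. x = v 0)" by (intro N_rules)
    then show ?thesis by (simp add: dpred1_def)
  qed
  have k: "dpred2 N k"
    unfolding N.dpred_unfold k_def by (intro NG_rules dpred1_app[OF N_U])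
  have D: "dpred1 N D"
    unfolding N.dpred_unfold D_def Ms.diagonal_def Ms.opair_def Ms.upair_def
    by (intro NG_rules dpred2_app[OF k])
  have img: "\<exists>c. Ms.S c \<and> (\<forall>w. Ms.E w c \<longleftrightarrow> (\<exists>u. D u \<and> B u \<and> k u w))"
    if B: "dpred1 N B" for B
  proof (rule Ms_collect[OF _ pb(1)])
    have "dpred N (\<lambda>v. \<exists>u\<in>N.U. D u \<and> B u \<and> k u (v 0))"
      by (intro NG_rules dpred1_app[OF D] dpred1_app[OF B] dpred2_app[OF k])
    moreover have "(\<exists>u\<in>N.U. D u \<and> B u \<and> k u w) \<longleftrightarrow> (\<exists>u. D u \<and> B u \<and> k u w)" for w
      unfolding k_def by blast
    ultimately show "dpred1 N (\<lambda>w. \<exists>u. D u \<and> B u \<and> k u w)" unfolding N.dpred_unfold by simp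
    show "Ms.E w pb" if "\<exists>u. D u \<and> B u \<and> k u w" for w
      using that pb(2) b(2) unfolding k_iff by blast
  qed
  have notS: "dpred1 N (\<lambda>u. \<not> N.S u)" unfolding N.dpred_unfold by (intro N_rules)
  obtain c where c: "Ms.S c" "\<forall>w. Ms.E w c \<longleftrightarrow> (\<exists>u. D u \<and> N.S u \<and> k u w)"
    using img[OF N.dpred1_set] by blast
  obtain d where d: "Ms.S d" "\<forall>w. Ms.E w d \<longleftrightarrow> (\<exists>u. D u \<and> \<not> N.S u \<and> k u w)"
    using img[OF notS] by blast
  show False
  proof (rule Ms.no_two_to_one_map[where k = k and A = N.S and a = c and b = d])
    fix u assume u: "Ms.S u"
    then have uU: "u \<in> N.U" by (rule Ms_set_univ)
    define Q where "Q t \<longleftrightarrow> (\<exists>z\<in>N.U. N.E z u \<and> G z t)" for t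
    have "dpred1 N Q"
      unfolding N.dpred_unfold Q_def using uU by (intro NG_rules)
    moreover have "Ms.E t b" if "Q t" for t using that b(2) unfolding Q_def by blast
    ultimately obtain w where w: "Ms.S w" "\<forall>t. Ms.E t w \<longleftrightarrow> Q t"
      using Ms_collect[OF _ b(1)] by blast
    then have "k u w" unfolding k_def Q_def using uU by blast
    then show "\<exists>w\<in>Ms.U. k u w" using w(1) Ms.set_in_U by blast
  next
    fix u u' w assume k: "k u w" "k u' w" and A: "N.S u = N.S u'"
    have "N.E z u'" if z: "N.E z u" and k: "k u w" "k u' w" for z u u'
    proof -
      obtain t where t: "G z t" using total N.mem_set[OF z] by blast
      then have "Ms.E t w" using k(1) z unfolding k_iff by blast
      then obtain z' where "N.E z' u'" "G z' t" using k(2) unfolding k_iff by blast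
      then show ?thesis using G_inject t by blast
    qed
    then have "N.E z u \<longleftrightarrow> N.E z u'" for z using k by blast
    then show "u = u'" using k A unfolding k_def by (intro N.ext) auto
  next
    fix u w w' assume "k u w" "k u w'"
    then show "w = w'" unfolding k_iff by (intro Ms.ext_sets) auto
  qed (use c d in \<open>simp_all add: D_def\<close>)
qed

lemma G_total: "N.S y \<Longrightarrow> \<exists>w. G y w" and G_onto: "Ms.S w \<Longrightarrow> \<exists>z. G z w"
proof -
  have "(\<forall>y. N.S y \<longrightarrow> (\<exists>w. G y w)) \<and> (\<forall>w. Ms.S w \<longrightarrow> (\<exists>z. G z w))"
    using total_or_onto
  proof
    assume "\<forall>y. N.S y \<longrightarrow> (\<exists>w. G y w)"
    then show ?thesis using total_imp_onto by simp
  next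
    assume "\<forall>w. Ms.S w \<longrightarrow> (\<exists>z. G z w)"
    then show ?thesis using onto_imp_total by simp
  qed
  then show "N.S y \<Longrightarrow> \<exists>w. G y w" and "Ms.S w \<Longrightarrow> \<exists>z. G z w" by simp_all
qed

section \<open>The isomorphism of M and N\<close>

definition I :: "'a \<Rightarrow> 'a \<Rightarrow> bool" where
  "I x y \<longleftrightarrow> x \<in> M.U \<and> y \<in> N.U \<and> (M.S x \<longleftrightarrow> N.S y) \<and> preimage (f x) y"

lemma M_I: "dpred2 M I"
proof -
  have "dpred2 M (\<lambda>x y. y \<in> N.U \<and> (M.S x \<longleftrightarrow> N.S y) \<and> (x \<in> M.U \<and> preimage (f x) y))"
    unfolding M.dpred_unfold
    by (intro M_rules dpred2_app[OF M_preimage] dpred1_app[OF dpred_interp_univ[OF MN M.ne]])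
  moreover have "(\<lambda>x y. y \<in> N.U \<and> (M.S x \<longleftrightarrow> N.S y) \<and> (x \<in> M.U \<and> preimage (f x) y)) = I"
    by (auto simp: I_def fun_eq_iff)
  ultimately show ?thesis by simp
qed

lemma I_unique:
  assumes "I x y" "I x y'"
  shows "y = y'"
  by (rule preimage_unique[of "f x"]) (use assms in \<open>simp_all add: I_def\<close>)

lemma I_inject:
  assumes "I x y" "I x' y"
  shows "x = x'"
proof -
  have U: "x \<in> M.U" "x' \<in> M.U" using assms unfolding I_def by auto
  have "f x = f x'"
  proof (rule preimage_inject)
    show "preimage (f x) y" "preimage (f x') y" using assms unfolding I_def by auto
    show "Ms.S (f x) \<longleftrightarrow> Ms.S (f x')" using assms f_set[OF U(1)] f_set[OF U(2)] unfolding I_def by blast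
  qed (use G_onto f_univ U in auto)
  then show ?thesis by (rule f_inject[OF U])
qed

lemma G_preimage:
  assumes "G y t"
  shows "preimage t y"
  unfolding preimage_iff
proof
  fix z
  show "N.E z y \<longleftrightarrow> (\<exists>t'. G z t' \<and> Ms.E t' t)"
    using G_mem[OF assms] G_elem[OF assms, of z] G_inject by blast
qed

text \<open>On sets, \<open>I\<close> is \<open>f\<close> followed by the inverse of
  \<open>G\<close>: that value meets the definition of \<open>I\<close>, which is
  functional.\<close>

lemma I_set:
  assumes "x \<in> M.U" "M.S x"
  shows "I x y \<longleftrightarrow> G y (f x)"
proof -
  have "I x y" if "G y (f x)" for y
    using G_preimage[OF that] G_set[OF that] N.set_in_U assms unfolding I_def by blast
  moreover obtain y0 where "G y0 (f x)" using G_onto f_set assms by blast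
  ultimately show ?thesis using I_unique by blast
qed

lemma I_total:
  assumes x: "x \<in> M.U"
  shows "\<exists>y. I x y"
proof (cases "M.S x")
  case True
  then show ?thesis using I_set[OF x True] G_onto f_set[OF x] by blast
next
  case False
  \<comment> \<open>With the object \<open>f x\<close> of N as a parameter, the extension of the
    required class is definable in N.\<close>
  define Q where "Q z \<longleftrightarrow> (\<exists>t\<in>N.U. G z t \<and> Ms.E t (f x))" for z
  have "dpred1 N Q"
    unfolding N.dpred_unfold Q_def using Ms_univ[OF f_univ[OF x]] by (intro NG_rules)
  then obtain y where "y \<in> N.U" "\<not> N.S y" "\<forall>z. N.E z y \<longleftrightarrow> N.S z \<and> Q z"
    using N.comprehension by blast
  moreover have "Q z \<longrightarrow> N.S z" for z using G_set unfolding Q_def by blast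
  ultimately have "I x y" unfolding I_def preimage_def Q_def using x False by blast
  then show ?thesis ..
qed

lemma I_onto:
  assumes y: "y \<in> N.U"
  shows "\<exists>x. I x y"
proof (cases "N.S y")
  case True
  then obtain t where t: "G y t" using G_total by blast
  have S: "Ms.S t" using G_set[OF t] by blast
  then obtain x where x: "x \<in> M.U" "t = f x" using f_surj Ms.set_in_U by blast
  then have "M.S x" using S f_set by blast
  then show ?thesis using I_set x t by blast
next
  case False
  \<comment> \<open>This collection involves \<open>f\<close> and is formed by comprehension in M,
    with \<open>y\<close> as a parameter.\<close>
  define Q where "Q x \<longleftrightarrow> (\<exists>z\<in>N.U. \<exists>t\<in>N.U. (x \<in> M.U \<and> t = f x) \<and> N.E z y \<and> G z t)" for x
  have "dpred1 M Q"
    unfolding M.dpred_unfold Q_def using N_univ[OF y] by (intro M_rules)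
  then obtain X where X: "X \<in> M.U" "\<not> M.S X" "\<forall>x. M.E x X \<longleftrightarrow> M.S x \<and> Q x"
    using M.comprehension by blast
  have "N.E z y \<longleftrightarrow> (\<exists>t. G z t \<and> Ms.E t (f X))" for z
  proof
    assume z: "N.E z y"
    obtain t where t: "G z t" using G_total N.mem_set[OF z] by blast
    have S: "Ms.S t" using G_set[OF t] by blast
    then obtain x where x: "x \<in> M.U" "t = f x" using f_surj Ms.set_in_U by blast
    then have "M.S x" using S f_set by blast
    moreover have "Q x" unfolding Q_def using x z t G_univ[OF t] by blast
    ultimately have "Ms.E t (f X)" using X f_mem x by blast
    with t show "\<exists>t. G z t \<and> Ms.E t (f X)" by blast
  next
    assume "\<exists>t. G z t \<and> Ms.E t (f X)"
    then obtain t where t: "G z t" "Ms.E t (f X)" by blast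
    then obtain x where x: "x \<in> M.U" "t = f x" using f_surj Ms.mem_in_U by blast
    then have "Q x" using X f_mem t by blast
    then obtain z' where "N.E z' y" "G z' t" using x(2) unfolding Q_def by blast
    then show "N.E z y" using G_inject t(1) by blast
  qed
  then have "I X y" unfolding I_def preimage_iff using X False y by blast
  then show ?thesis ..
qed

lemma I_mem:
  assumes "I x y" "I x' y'"
  shows "M.E x x' \<longleftrightarrow> N.E y y'"
proof -
  have U: "x \<in> M.U" "x' \<in> M.U" and S: "M.S x \<longleftrightarrow> N.S y" and p: "preimage (f x') y'"
    using assms unfolding I_def by auto
  show ?thesis
  proof
    assume e: "M.E x x'"
    have "G y (f x)" using I_set[OF U(1) M.mem_set[OF e]] assms(1) by blast
    moreover have "Ms.E (f x) (f x')" using e f_mem[OF U] by blast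
    ultimately show "N.E y y'" using p unfolding preimage_iff by blast
  next
    assume e: "N.E y y'"
    then have "M.S x" using S N.mem_set[OF e] by blast
    then have "G y (f x)" using I_set[OF U(1)] assms(1) by blast
    moreover obtain t where "G y t" "Ms.E t (f x')" using p e unfolding preimage_iff by blast
    ultimately have "Ms.E (f x) (f x')" using G_unique by blast
    then show "M.E x x'" using f_mem[OF U] by blast
  qed
qed

lemma ex_definable_iso: "\<exists>i. definable_iso M N i"
proof -
  define i where "i x = (SOME y. I x y)" for x
  have I_i: "I x (i x)" if "x \<in> M.U" for x
    unfolding i_def using I_total[OF that] by (rule someI_ex)
  have I: "I x y \<longleftrightarrow> y = i x" if "x \<in> M.U" for x y
    using I_i[OF that] I_unique by blast
  have U: "x \<in> M.U" "y \<in> N.U" if "I x y" for x y using that unfolding I_def by auto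
  have bij: "bij_betw i M.U N.U"
  proof (rule bij_betwI')
    show "i x = i y \<longleftrightarrow> x = y" if "x \<in> M.U" "y \<in> M.U" for x y
      using I_inject[OF I_i[OF that(1)]] I_i[OF that(2)] by auto
    show "i x \<in> N.U" if "x \<in> M.U" for x using U(2)[OF I_i[OF that]] .
    show "\<exists>x\<in>M.U. y = i x" if "y \<in> N.U" for y
      using I_onto[OF that] I U(1) by blast
  qed
  have "as \<in> rel M p \<longleftrightarrow> map i as \<in> rel N p" if as: "set as \<subseteq> M.U" for p as
  proof (cases p)
    case SetP
    show ?thesis
    proof (cases "length as = 1")
      case True
      then obtain x where "as = [x]" by (auto simp: length_Suc_conv)
      then show ?thesis using I_i[of x] as SetP unfolding I_def is_set_def by simp
    next
      case False
      then show ?thesis using M.rel_length[of as p] N.rel_length[of "map i as" p] SetP by auto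
    qed
  next
    case MemP
    show ?thesis
    proof (cases "length as = 2")
      case True
      then obtain x y where "as = [x, y]" by (auto simp: length_Suc_conv numeral_2_eq_2)
      then show ?thesis
        using I_mem[OF I_i[of x] I_i[of y]] as MemP unfolding mem_def by simp
    next
      case False
      then show ?thesis using M.rel_length[of as p] N.rel_length[of "map i as" p] MemP by auto
    qed
  qed
  with bij have "isomorphism M N i" unfolding isomorphism_def by blast
  moreover have "definable M 2 {[a, i a] | a. a \<in> M.U}"
  proof -
    have "{[a, b] | a b. a \<in> M.U \<and> b \<in> M.U \<and> I a b} = {[a, i a] | a. a \<in> M.U}"
      using I N_univ[OF U(2)[OF I_i]] by auto
    then show ?thesis using definable_dpred2[OF M_I] by simp
  qed
  ultimately show ?thesis unfolding definable_iso_def by blast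
qed

end

theorem theorem2p7: "solid TYPE('a) km_arity KM"
  unfolding solid_def
proof (intro allI impI)
  fix M Ms N :: "('a, km_pred) struct"
  assume *: "model_of km_arity M KM \<and> model_of km_arity Ms KM \<and> model_of km_arity N KM \<and>
    interprets_par km_arity M N \<and> interprets_par km_arity N Ms \<and> (\<exists>f. definable_iso M Ms f)"
  then obtain f where f: "definable_iso M Ms f" by (elim conjE exE)
  have "km_model M" "km_model N" "km_model Ms" using * by (simp_all add: km_model_def)
  moreover have "km_triple_axioms M N Ms f" using * f by (simp add: km_triple_axioms_def)
  ultimately have "km_triple M N Ms f" by (rule km_triple.intro)
  then show "\<exists>i. definable_iso M N i" by (rule km_triple.ex_definable_iso)
qed

end
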